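(* Let $A=R/J$ be an Artinian Gorenstein $k$-algebra, and let $I$ be an ideal in $A$ with end degree $u$. Then the following are equivalent: (i) $G(I)$ is Gorenstein of socle degree $u$; (ii) $C(1)=0$; (iii) $C(i)=0$ for all $i\ge 1$; (iv) $Q(i)=0$ for all $i\ge 1$; (v) the Hilbert function $\mathrm{HF}(G(I))$ is symmetric, i.e. $\mathrm{HF}(G(I))_i=\mathrm{HF}(G(I))_{u-i}$ for all $i$.
   Context: Setting: $k$ is a field, $(R,\mathcal M)$ is a local ring over $k$ (a local $k$-algebra) with $k=R/\mathcal M$, and $J$ is an ideal of $R$ such that $A=R/J$ is an Artinian Gorenstein local ring ("AG $k$-algebra"); $\mathfrak m=\mathcal M/J$. For an ideal $I$ of $A$, the end degree of $I$ is the integer $u\ge 0$ with $I^u\ne 0$ and $I^{u+1}=0$. The associated graded ring is $G(I)=\bigoplus_{n\ge 0}I^n/I^{n+1}$, where $I^0=A$, and $\mathrm{HF}(G(I))_i=\ell_{A/I}(I^i/I^{i+1})$. For an ideal $L$ of $A$, $(0:L)=\{x\in A: xL=0\}$, and $I^n=A$ for $n\le 0$. For $a\geq 0$, $C(a)$ is the graded ideal of $G(I)$ whose component in degree $i\ge 0$ is $$C(a)_i=\frac{(0:I^{u+1-a-i})\cap I^i}{(0:I^{u+1-a-i})\cap I^{i+1}}\cong\frac{(0:I^{u+1-a-i})\cap I^i+I^{i+1}}{I^{i+1}}\subseteq I^i/I^{i+1}.$$ These form a decreasing sequence $G(I)=C(0)\supseteq C(1)\supseteq\cdots\supseteq C(u+1)=0$.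 Set $Q(a)=C(a)/C(a+1)$. A graded Artinian quotient $S$ of $G(I)$ (with degree-zero part local) is Gorenstein of socle degree $u$ if its socle, the annihilator of its unique homogeneous maximal ideal, is a one-dimensional $k$-vector space concentrated in degree $u$. *)

theory Defs
  imports "HOL-Algebra.Algebra" "HOL-Library.Extended_Nat"
begin

definition local_ring :: "('a, 'b) ring_scheme \<Rightarrow> 'a set \<Rightarrow> bool" where
  "local_ring R M \<longleftrightarrow> cring R \<and> maximalideal M R \<and> (\<forall>N. maximalideal N R \<longrightarrow> N = M)"

definition artinian_ring :: "('a, 'b) ring_scheme \<Rightarrow> bool" where
  "artinian_ring R \<longleftrightarrow> ring R \<and>
     (\<forall>N :: nat \<Rightarrow> 'a set. (\<forall>n. ideal (N n) R) \<and> (\<forall>n. N (Suc n) \<subseteq> N n) \<longrightarrow>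
        (\<exists>m. \<forall>n\<ge>m. N n = N m))"

text \<open>\<open>(0 : L)\<close>\<close>

definition annihilator :: "('a, 'b) ring_scheme \<Rightarrow> 'a set \<Rightarrow> 'a set" where
  "annihilator R L = {x \<in> carrier R. \<forall>y\<in>L. x \<otimes>\<^bsub>R\<^esub> y = \<zero>\<^bsub>R\<^esub>}"

text \<open>The field \<open>k\<close> enters only through its image \<open>F\<close>, a subfield of the local ring \<open>A\<close>;
  the socle \<open>(0 : m)\<close> has to be one-dimensional over it.\<close>

definition artinian_gorenstein :: "('a, 'b) ring_scheme \<Rightarrow> 'a set \<Rightarrow> 'a set \<Rightarrow> bool" where
  "artinian_gorenstein A F m \<longleftrightarrow>
     local_ring A m \<and> artinian_ring A \<and> ring.dimension A 1 F (annihilator A m)"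

text \<open>Supremum of the lengths of strict chains of submodules.\<close>

definition module_length :: "('a, 'b) ring_scheme \<Rightarrow> ('a, 'c, 'd) module_scheme \<Rightarrow> enat" where
  "module_length R V = Sup {enat n | n. \<exists>N :: nat \<Rightarrow> 'c set.
     (\<forall>i\<le>n. submodule (N i) R V) \<and> (\<forall>i<n. N i \<subset> N (Suc i))}"

text \<open>\<open>I\<^sup>0\<close> is the unit ideal, the neutral element of the monoid of ideals.\<close>

definition ideal_pow :: "('a, 'b) ring_scheme \<Rightarrow> 'a set \<Rightarrow> nat \<Rightarrow> 'a set" where
  "ideal_pow A I n = I [^]\<^bsub>ideals_set A\<^esub> n"

definition end_degree :: "('a, 'b) ring_scheme \<Rightarrow> 'a set \<Rightarrow> nat \<Rightarrow> bool" where
  "end_degree A I u \<longleftrightarrow> ideal_pow A I u \<noteq> {\<zero>\<^bsub>A\<^esub>} \<and> ideal_pow A I (Suc u) = {\<zero>\<^bsub>A\<^esub>}"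


section \<open>The associated graded ring\<close>

text \<open>The class of \<open>x \<in> I\<^sup>n\<close> in \<open>I\<^sup>n / I\<^sup>n\<^sup>+\<^sup>1\<close>, as a coset in \<open>A\<close>.\<close>

definition gr_class :: "('a, 'b) ring_scheme \<Rightarrow> 'a set \<Rightarrow> nat \<Rightarrow> 'a \<Rightarrow> 'a set" where
  "gr_class A I n x = ideal_pow A I (Suc n) +>\<^bsub>A\<^esub> x"

text \<open>\<open>I\<^sup>n / I\<^sup>n\<^sup>+\<^sup>1\<close> as a module over \<open>A / I\<close>. The scalar action sends the cosets of \<open>a\<close> and
  \<open>x\<close> to the coset of \<open>a x\<close>. The fields \<open>mult\<close> and \<open>one\<close> of the record play no role for modules.\<close>

definition gr_module :: "('a, 'b) ring_scheme \<Rightarrow> 'a set \<Rightarrow> nat \<Rightarrow> ('a set, 'a set) module" where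
  "gr_module A I n =
     \<lparr>carrier = gr_class A I n ` ideal_pow A I n,
      monoid.mult = undefined, one = undefined,
      ring.zero = ideal_pow A I (Suc n), ring.add = set_add A,
      smult = rcoset_mult A (ideal_pow A I (Suc n))\<rparr>"

text \<open>The Hilbert function, extended by zero to negative degrees.\<close>

definition gr_HF :: "('a, 'b) ring_scheme \<Rightarrow> 'a set \<Rightarrow> int \<Rightarrow> enat" where
  "gr_HF A I i = (if i < 0 then 0 else module_length (A Quot I) (gr_module A I (nat i)))"

text \<open>The map \<open>A \<rightarrow> A / I = G(I)\<^sub>0 \<subseteq> G(I)\<close>.\<close>

definition gr_const :: "('a, 'b) ring_scheme \<Rightarrow> 'a set \<Rightarrow> 'a \<Rightarrow> nat \<Rightarrow> 'a set" where
  "gr_const A I a = (\<lambda>n. gr_class A I n (if n = 0 then a else \<zero>\<^bsub>A\<^esub>))"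

text \<open>An element of \<open>G(I)\<close> is a finitely supported sequence of classes
  \<open>f n \<in> I\<^sup>n / I\<^sup>n\<^sup>+\<^sup>1\<close>. In degree \<open>n\<close> the product is the sum over \<open>i \<le> n\<close> of the products
  \<open>I\<^sup>i / I\<^sup>i\<^sup>+\<^sup>1 \<times> I\<^sup>n\<^sup>-\<^sup>i / I\<^sup>n\<^sup>-\<^sup>i\<^sup>+\<^sup>1 \<rightarrow> I\<^sup>n / I\<^sup>n\<^sup>+\<^sup>1\<close> induced by multiplication in \<open>A\<close>.\<close>

definition gr_ring :: "('a, 'b) ring_scheme \<Rightarrow> 'a set \<Rightarrow> (nat \<Rightarrow> 'a set) ring" where
  "gr_ring A I =
     \<lparr>carrier = {f. (\<forall>n. f n \<in> gr_class A I n ` ideal_pow A I n) \<and>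
                    finite {n. f n \<noteq> ideal_pow A I (Suc n)}},
      monoid.mult = (\<lambda>f g n. finsum (A Quot ideal_pow A I (Suc n))
                (\<lambda>i. rcoset_mult A (ideal_pow A I (Suc n)) (f i) (g (n - i))) {..n}),
      one = gr_const A I \<one>\<^bsub>A\<^esub>,
      ring.zero = (\<lambda>n. ideal_pow A I (Suc n)),
      ring.add = (\<lambda>f g n. f n <+>\<^bsub>A\<^esub> g n)\<rparr>"

definition gr_homogeneous :: "('a, 'b) ring_scheme \<Rightarrow> 'a set \<Rightarrow> (nat \<Rightarrow> 'a set) set \<Rightarrow> bool" where
  "gr_homogeneous A I N \<longleftrightarrow>
     (\<forall>f\<in>N. \<forall>n. (\<lambda>i. if i = n then f i else \<zero>\<^bsub>gr_ring A I\<^esub> i) \<in> N)"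

definition gr_max :: "('a, 'b) ring_scheme \<Rightarrow> 'a set \<Rightarrow> (nat \<Rightarrow> 'a set) set" where
  "gr_max A I = (THE N. maximalideal N (gr_ring A I) \<and> gr_homogeneous A I N)"

definition gr_socle :: "('a, 'b) ring_scheme \<Rightarrow> 'a set \<Rightarrow> (nat \<Rightarrow> 'a set) set" where
  "gr_socle A I = annihilator (gr_ring A I) (gr_max A I)"

text \<open>\<open>G(I)\<close> is Gorenstein of socle degree \<open>u\<close>; as before, \<open>F\<close> is the image of \<open>k\<close> in \<open>A\<close>.\<close>

definition gr_gorenstein ::
    "('a, 'b) ring_scheme \<Rightarrow> 'a set \<Rightarrow> 'a set \<Rightarrow> nat \<Rightarrow> bool" where
  "gr_gorenstein A F I u \<longleftrightarrow>
     ring.dimension (gr_ring A I) 1 (gr_const A I ` F) (gr_socle A I) \<and>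
     (\<forall>f \<in> gr_socle A I. \<forall>n. n \<noteq> u \<longrightarrow> f n = \<zero>\<^bsub>gr_ring A I\<^esub> n)"

text \<open>The ideal \<open>C(a)\<close>, with \<open>C(a)\<^sub>i\<close> as a subset of \<open>I\<^sup>i / I\<^sup>i\<^sup>+\<^sup>1\<close>, and \<open>Q(a) = C(a) / C(a + 1)\<close>
  as a set of cosets. Truncated subtraction of natural numbers accounts for the convention
  \<open>I\<^sup>n = A\<close> for \<open>n \<le> 0\<close>.\<close>

definition gr_C ::
    "('a, 'b) ring_scheme \<Rightarrow> 'a set \<Rightarrow> nat \<Rightarrow> nat \<Rightarrow> (nat \<Rightarrow> 'a set) set" where
  "gr_C A I u a =
     {f \<in> carrier (gr_ring A I).
        \<forall>i. f i \<in> gr_class A I i ` (annihilator A (ideal_pow A I (u + 1 - a - i)) \<inter> ideal_pow A I i)}"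

definition gr_Q ::
    "('a, 'b) ring_scheme \<Rightarrow> 'a set \<Rightarrow> nat \<Rightarrow> nat \<Rightarrow> (nat \<Rightarrow> 'a set) set set" where
  "gr_Q A I u a = (\<lambda>f. gr_C A I u (a + 1) +>\<^bsub>gr_ring A I\<^esub> f) ` gr_C A I u a"

end

(* Everything is equivalent to the self-duality I^i = (0 : I^(u+1-i)) for 0 <= i <= u+1. In an Artinian
   Gorenstein local ring every ideal L satisfies (0 : (0 : L)) = L, so annihilators reverse chains of
   ideals, and the length of (0 : I^(u-i+1)) / (0 : I^(u-i)) is HF(u-i). Starting from
   I^0 = (0 : I^(u+1)), induction on i compares I^(i+1) with (0 : I^(u-i)), which contains it: both
   C(1) = 0 and the symmetry of HF force equality, the latter because lengths are finite.
   If C(1) = 0, pairing an element of degree i < u with I^(u-i) shows that the socle of G(I) lies in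
   degree u, where it is the socle of A. Conversely a nonzero C(1) meets the socle of G(I) in a
   degree below u. *)

theory Submission
  imports Defs
begin

section \<open>Ideals and annihilators\<close>

text \<open>The double annihilator property is not part of the definition; it has to come out of a
  one-dimensional socle and descending chains. The obstacle is that an ideal just below a given one,
  with simple quotient, is a maximal element of a set of ideals, while the Artinian condition
  supplies minimal elements. Annihilators turn one into the other, but only where the property
  already holds, so both are obtained together in a minimal-counterexample argument. The same covers
  then give finite length. Lengths are measured by chains of ideals of the ring itself rather than
  by modules over A / I, because annihilators act on such chains. Symmetry of HF then compares two
  intervals with common top I^i, and finite length lets equal lengths exclude a strict inclusion of
  the bottoms. To spare a direct check of the ring laws, G(I) is treated as the image of the Rees
  algebra, a subring of the polynomial ring.\<close>

context cring
begin

lemma annihilator_ideal: "L \<subseteq> carrier R \<Longrightarrow> ideal (annihilator R L) R"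
proof (rule idealI)
  assume L: "L \<subseteq> carrier R"
  show "ring R" by (rule ring_axioms)
  show "subgroup (annihilator R L) (add_monoid R)"
    using L
    by (intro add.subgroupI) (auto simp: annihilator_def l_distr l_minus a_inv_def[symmetric] subset_iff)
  fix a x
  assume "a \<in> annihilator R L" "x \<in> carrier R"
  then show "x \<otimes> a \<in> annihilator R L" "a \<otimes> x \<in> annihilator R L"
    using L by (auto simp: annihilator_def subset_iff m_assoc m_comm[of a x])
qed

lemma annihilator_antimono: "L \<subseteq> L' \<Longrightarrow> annihilator R L' \<subseteq> annihilator R L"
  by (auto simp: annihilator_def)

lemma annihilator_annihilator_superset: "L \<subseteq> carrier R \<Longrightarrow> L \<subseteq> annihilator R (annihilator R L)"
  by (auto simp: annihilator_def subset_iff m_comm)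

lemma annihilator_zero: "annihilator R {\<zero>} = carrier R"
  by (auto simp: annihilator_def)

lemma annihilator_carrier: "annihilator R (carrier R) = {\<zero>}"
proof -
  have "x = \<zero>" if "x \<in> annihilator R (carrier R)" for x
  proof -
    have "x \<in> carrier R" "x \<otimes> \<one> = \<zero>"
      using that one_closed unfolding annihilator_def by blast+
    then show ?thesis by simp
  qed
  then show ?thesis by (auto simp: annihilator_def)
qed

lemma ideal_subset: "ideal N R \<Longrightarrow> N \<subseteq> carrier R"
  by (auto dest: ideal.Icarr)

lemma ideal_zero: "ideal N R \<Longrightarrow> \<zero> \<in> N"
  by (simp add: additive_subgroup.zero_closed ideal.axioms(1))

lemma ideal_add: "ideal N R \<Longrightarrow> x \<in> N \<Longrightarrow> y \<in> N \<Longrightarrow> x \<oplus> y \<in> N"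
  by (simp add: additive_subgroup.a_closed ideal.axioms(1))

lemma ideal_minus: "ideal N R \<Longrightarrow> x \<in> N \<Longrightarrow> \<ominus> x \<in> N"
  by (simp add: additive_subgroup.a_inv_closed ideal.axioms(1))

lemma ideal_diff: "ideal N R \<Longrightarrow> x \<in> N \<Longrightarrow> y \<in> N \<Longrightarrow> x \<ominus> y \<in> N"
  by (simp add: a_minus_def ideal_add ideal_minus)

lemma ideal_mult: "ideal N R \<Longrightarrow> x \<in> N \<Longrightarrow> r \<in> carrier R \<Longrightarrow> r \<otimes> x \<in> N"
  by (rule ideal.I_l_closed)

lemma ideal_ne_zero_obtain:
  assumes "ideal N R" "N \<noteq> {\<zero>}" obtains x where "x \<in> N" "x \<noteq> \<zero>"
  using assms ideal_zero by blast

text \<open>The explicit elements of L + (x) turn simplicity of a quotient into an equation between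
  elements.\<close>

lemma ideal_sum_principal:
  assumes L: "ideal L R" and x: "x \<in> carrier R"
  defines "S \<equiv> {l \<oplus> r \<otimes> x | l r. l \<in> L \<and> r \<in> carrier R}"
  shows "ideal S R" "L \<subseteq> S" "x \<in> S"
proof -
  note Lc = ideal.Icarr[OF L]
  show "ideal S R"
  proof (rule idealI)
    show "ring R" by (rule ring_axioms)
    show "subgroup S (add_monoid R)"
    proof (rule add.subgroupI)
      show "S \<subseteq> carrier R" using Lc x by (auto simp: S_def)
      show "S \<noteq> {}" using ideal_zero[OF L] by (auto simp: S_def)
    next
      fix a assume "a \<in> S"
      then obtain l r where "a = l \<oplus> r \<otimes> x" "l \<in> L" "r \<in> carrier R" by (auto simp: S_def)
      then have "\<ominus> a = \<ominus> l \<oplus> (\<ominus> r) \<otimes> x" "\<ominus> l \<in> L" "\<ominus> r \<in> carrier R"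
        using Lc x ideal_minus[OF L] by (auto simp: minus_add l_minus)
      then show "\<ominus> a \<in> S" by (auto simp: S_def)
    next
      fix a b assume "a \<in> S" "b \<in> S"
      then obtain l r l' r' where "a = l \<oplus> r \<otimes> x" "l \<in> L" "r \<in> carrier R"
        "b = l' \<oplus> r' \<otimes> x" "l' \<in> L" "r' \<in> carrier R" by (auto simp: S_def)
      then have "a \<oplus> b = (l \<oplus> l') \<oplus> (r \<oplus> r') \<otimes> x" "l \<oplus> l' \<in> L" "r \<oplus> r' \<in> carrier R"
        using Lc x ideal_add[OF L] by (auto simp: l_distr a_ac)
      then show "a \<oplus> b \<in> S" by (auto simp: S_def)
    qed
    have "c \<otimes> a \<in> S" if "a \<in> S" "c \<in> carrier R" for a c
    proof -
      from that obtain l r where "a = l \<oplus> r \<otimes> x" "l \<in> L" "r \<in> carrier R" by (auto simp: S_def)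
      then have "c \<otimes> a = c \<otimes> l \<oplus> (c \<otimes> r) \<otimes> x" "c \<otimes> l \<in> L" "c \<otimes> r \<in> carrier R"
        using Lc x that ideal_mult[OF L] by (auto simp: r_distr m_assoc)
      then show ?thesis by (auto simp: S_def)
    qed
    moreover have "a \<in> carrier R" if "a \<in> S" for a using that Lc x by (auto simp: S_def)
    ultimately show "c \<otimes> a \<in> S" "a \<otimes> c \<in> S" if "a \<in> S" "c \<in> carrier R" for a c
      using that by (auto simp: m_comm[of a c])
  qed
  show "L \<subseteq> S"
  proof
    fix l assume "l \<in> L"
    then have "l = l \<oplus> \<zero> \<otimes> x" using Lc x by simp
    with \<open>l \<in> L\<close> show "l \<in> S" unfolding S_def by blast
  qed
  have "x = \<zero> \<oplus> \<one> \<otimes> x" using x by simp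
  then show "x \<in> S" unfolding S_def using ideal_zero[OF L] by blast
qed

text \<open>This is the colon ideal (N : x). Because it is an ideal, a condition
  \<open>x \<otimes> y \<in> N\<close> on a power of I need only be tested on products that generate
  the power.\<close>

lemma colon_ideal:
  assumes x: "x \<in> carrier R" and N: "ideal N R"
  shows "ideal {y \<in> carrier R. x \<otimes> y \<in> N} R"
proof (rule idealI)
  show "ring R" by (rule ring_axioms)
  show "subgroup {y \<in> carrier R. x \<otimes> y \<in> N} (add_monoid R)"
    using x N ideal_zero[OF N]
    by (intro add.subgroupI) (auto simp: r_distr r_minus ideal_add ideal_minus)
  fix a r assume a: "a \<in> {y \<in> carrier R. x \<otimes> y \<in> N}" and r: "r \<in> carrier R"
  then have "x \<otimes> (r \<otimes> a) \<in> N" using ideal_mult[OF N, of "x \<otimes> a" r] x by (simp add: m_lcomm)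
  then show "r \<otimes> a \<in> {y \<in> carrier R. x \<otimes> y \<in> N}" "a \<otimes> r \<in> {y \<in> carrier R. x \<otimes> y \<in> N}"
    using a r by (auto simp: m_comm)
qed

text \<open>Without a minimal member, dependent choice would build a strictly descending sequence.
  The Artinian hypothesis is always applied through this minimum condition.\<close>

lemma artinian_minimal:
  assumes "artinian_ring R" "S \<noteq> {}" "\<And>N. N \<in> S \<Longrightarrow> ideal N R"
  shows "\<exists>N\<in>S. \<forall>N'\<in>S. N' \<subseteq> N \<longrightarrow> N' = N"
proof (rule ccontr)
  assume "\<not> ?thesis"
  then have next_ex: "\<exists>N'. N' \<in> S \<and> N' \<subset> N" if "N \<in> S" for N using \<open>N \<in> S\<close> by blast
  have "\<exists>N. \<forall>n. N n \<in> S \<and> N (Suc n) \<subset> N n"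
    by (rule dependent_nat_choice) (use \<open>S \<noteq> {}\<close> next_ex in auto)
  then obtain N :: "nat \<Rightarrow> 'a set" where N: "\<And>n. N n \<in> S" "\<And>n. N (Suc n) \<subset> N n"
    by blast
  then obtain m where "\<forall>n\<ge>m. N n = N m"
    using assms(1,3) unfolding artinian_ring_def by (metis less_imp_le)
  then show False using N(2)[of m] by (metis le_Suc_eq order_refl psubset_eq)
qed

text \<open>Zorn's lemma on the ideals that contain a and omit 1. It converts uniqueness of the
  maximal ideal into the usable form of locality: elements outside it are units.\<close>

lemma nonunit_in_maximalideal:
  assumes a: "a \<in> carrier R" "a \<notin> Units R"
  obtains N where "maximalideal N R" "a \<in> N"
proof -
  define S where "S = {N. ideal N R \<and> a \<in> N \<and> \<one> \<notin> N}"
  have "PIdl a \<in> S"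
    using a cgenideal_ideal cgenideal_self
    by (auto simp: S_def cgenideal_def Units_def m_comm)
  moreover have "\<Union>C \<in> S" if C: "subset.chain S C" "C \<noteq> {}" for C
  proof -
    have "subset.chain {N. ideal N R} C" using C(1) by (auto simp: S_def pred_on.chain_def)
    then have "ideal (\<Union>C) R" using chain_Union_is_ideal[of C] C(2) by auto
    with C show ?thesis by (auto simp: S_def pred_on.chain_def)
  qed
  ultimately obtain N where N: "N \<in> S" "\<And>N'. N' \<in> S \<Longrightarrow> N \<subseteq> N' \<Longrightarrow> N' = N"
    using subset_Zorn_nonempty[of S] by (metis empty_iff)
  have "maximalideal N R"
  proof (rule maximalidealI)
    show "ideal N R" "carrier R \<noteq> N" using N(1) by (auto simp: S_def)
  next
    fix N' assume "ideal N' R" "N \<subseteq> N'" "N' \<subseteq> carrier R"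
    then show "N' = N \<or> N' = carrier R"
      using N ideal.one_imp_carrier[of N' R] by (auto simp: S_def)
  qed
  with N(1) that show thesis by (auto simp: S_def)
qed

end

section \<open>The double annihilator property\<close>

text \<open>The quotient L / L' is a simple module; the smaller ideal comes first. Stated in the
  lattice of ideals, so that no quotient module has to be formed.\<close>

definition ideal_covers :: "('a, 'b) ring_scheme \<Rightarrow> 'a set \<Rightarrow> 'a set \<Rightarrow> bool" where
  "ideal_covers R L' L \<longleftrightarrow> ideal L' R \<and> ideal L R \<and> L' \<subset> L \<and>
     (\<forall>N. ideal N R \<longrightarrow> L' \<subseteq> N \<longrightarrow> N \<subseteq> L \<longrightarrow> N = L' \<or> N = L)"

lemma ideal_coversD:
  assumes "ideal_covers R L' L"
  shows "ideal L' R" "ideal L R" "L' \<subseteq> L" "L' \<noteq> L"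
    "\<And>N. ideal N R \<Longrightarrow> L' \<subseteq> N \<Longrightarrow> N \<subseteq> L \<Longrightarrow> N = L' \<or> N = L"
  using assms by (auto simp: ideal_covers_def)

text \<open>The ideal L' + (x) lies between L' and L and differs from L', so it is L: a simple
  quotient is generated by any nonzero class.\<close>

lemma (in cring) ideal_covers_generated:
  assumes cov: "ideal_covers R L' L" and x: "x \<in> L" "x \<notin> L'" and y: "y \<in> L"
  obtains l r where "y = l \<oplus> r \<otimes> x" "l \<in> L'" "r \<in> carrier R"
proof -
  note idL' = ideal_coversD(1)[OF cov] and idL = ideal_coversD(2)[OF cov]
  have xc: "x \<in> carrier R" by (rule ideal.Icarr[OF idL x(1)])
  define S where "S = {l \<oplus> r \<otimes> x | l r. l \<in> L' \<and> r \<in> carrier R}"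
  note S = ideal_sum_principal[OF idL' xc, folded S_def]
  have "S \<subseteq> L"
    using ideal_coversD(3)[OF cov] ideal_add[OF idL] ideal_mult[OF idL x(1)] by (auto simp: S_def)
  with ideal_coversD(5)[OF cov S(1,2)] S(3) x have "S = L" by auto
  with y that show thesis by (auto simp: S_def)
qed

text \<open>The hypotheses in elementwise form: locality is invertibility outside m, and the
  one-dimensional socle is F v with basis vector v. Invertibility of the nonzero elements of F makes
  each nonzero socle element a generator of the socle.\<close>

locale gorenstein_local = cring R for R (structure) +
  fixes m :: "'a set" and F :: "'a set" and v :: 'a
  assumes m_ideal: "ideal m R"
    and one_notin_m: "\<one> \<notin> m"
    and unit_of_notin_m: "a \<in> carrier R \<Longrightarrow> a \<notin> m \<Longrightarrow> a \<in> Units R"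
    and artinian: "artinian_ring R"
    and F_subset: "F \<subseteq> carrier R"
    and F_unit: "c \<in> F \<Longrightarrow> c \<noteq> \<zero> \<Longrightarrow> c \<in> Units R"
    and v_closed: "v \<in> carrier R"
    and v_nonzero: "v \<noteq> \<zero>"
    and socle: "annihilator R m = (\<lambda>c. c \<otimes> v) ` F"
begin

abbreviation ann where "ann \<equiv> annihilator R"

lemma m_subset: "m \<subseteq> carrier R"
  by (rule ideal_subset[OF m_ideal])

lemma ann_ideal: "ideal N R \<Longrightarrow> ideal (ann N) R"
  by (rule annihilator_ideal[OF ideal_subset])

lemma ideal_eq_carrier: "ideal N R \<Longrightarrow> N = carrier R" if "a \<in> N" "a \<notin> m" for a N
proof -
  assume N: "ideal N R"
  with that have "a \<in> Units R" using unit_of_notin_m ideal.Icarr[OF N] by simp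
  then have "inv a \<otimes> a = \<one>" "inv a \<in> carrier R" by auto
  with ideal_mult[OF N \<open>a \<in> N\<close>] have "\<one> \<in> N" by metis
  then show ?thesis by (rule ideal.one_imp_carrier[OF N])
qed

text \<open>With s = c v and t = d v the multiplier is d / c. One-dimensionality over F thus becomes
  simplicity of the socle as a module over the ring.\<close>

lemma socle_generated:
  assumes "s \<in> ann m" "s \<noteq> \<zero>" "t \<in> ann m"
  obtains r where "r \<in> carrier R" "t = r \<otimes> s"
proof -
  obtain c d where c: "c \<in> F" "s = c \<otimes> v" and d: "d \<in> F" "t = d \<otimes> v"
    using assms socle by auto
  have "c \<noteq> \<zero>" using assms(2) c v_closed by auto
  then have cu: "c \<in> Units R" using c F_unit by blast
  have dc: "d \<in> carrier R" using d F_subset by blast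
  have "t = (d \<otimes> inv c) \<otimes> s"
  proof -
    have "c \<in> carrier R" "inv c \<in> carrier R" using cu by auto
    then have "(d \<otimes> inv c) \<otimes> (c \<otimes> v) = d \<otimes> (inv c \<otimes> c) \<otimes> v"
      using dc v_closed by (simp only: m_assoc m_closed)
    then show ?thesis using c d cu dc by simp
  qed
  moreover have "d \<otimes> inv c \<in> carrier R" using cu dc by auto
  ultimately show thesis using that by blast
qed

text \<open>Nakayama for a simple quotient: if \<open>a x\<close> generated \<open>L\<close> modulo \<open>L'\<close>, then
  \<open>(1 - b a) x \<in> L'\<close> for some \<open>b\<close>, with \<open>1 - b a\<close> a unit.\<close>

lemma m_mult_covers:
  assumes cov: "ideal_covers R L' L" and x: "x \<in> L" and a: "a \<in> m"
  shows "a \<otimes> x \<in> L'"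
proof (rule ccontr)
  assume ax: "a \<otimes> x \<notin> L'"
  note idL' = ideal_coversD(1)[OF cov] and idL = ideal_coversD(2)[OF cov]
  have xc: "x \<in> carrier R" and ac: "a \<in> carrier R"
    using ideal.Icarr[OF idL x] ideal.Icarr[OF m_ideal a] .
  have axL: "a \<otimes> x \<in> L" by (rule ideal_mult[OF idL x ac])
  obtain l b where l: "x = l \<oplus> b \<otimes> (a \<otimes> x)" "l \<in> L'" "b \<in> carrier R"
    by (rule ideal_covers_generated[OF cov axL ax x])
  have lc: "l \<in> carrier R" by (rule ideal.Icarr[OF idL' l(2)])
  let ?c = "\<one> \<ominus> b \<otimes> a"
  have cc: "?c \<in> carrier R" using l(3) ac by simp
  have "?c \<notin> m"
  proof
    assume "?c \<in> m"
    then have "?c \<oplus> b \<otimes> a \<in> m" using ideal_add[OF m_ideal] ideal_mult[OF m_ideal a l(3)] by simp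
    moreover have "?c \<oplus> b \<otimes> a = \<one>" using l(3) ac by (simp add: a_minus_def a_assoc l_neg)
    ultimately show False using one_notin_m by simp
  qed
  then have cu: "?c \<in> Units R" using unit_of_notin_m cc by simp
  have "?c \<otimes> x = x \<ominus> b \<otimes> (a \<otimes> x)"
    using l(3) ac xc by (simp add: a_minus_def l_distr l_minus m_assoc)
  also have "\<dots> = l" using l(1,3) ac xc lc
    by (metis (no_types) a_minus_def a_assoc a_inv_closed m_closed r_neg r_zero)
  finally have "?c \<otimes> x \<in> L'" using l(2) by simp
  then have "inv ?c \<otimes> (?c \<otimes> x) \<in> L'" using ideal_mult[OF idL'] cu by simp
  moreover have "inv ?c \<otimes> (?c \<otimes> x) = x"
    using cu xc cc by (metis Units_inv_closed Units_l_inv l_one m_assoc)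
  ultimately have "x \<in> L'" by simp
  then show False using ax ideal_mult[OF idL' _ ac] by simp
qed

text \<open>If \<open>L / L'\<close> is generated by the class of \<open>x\<close>, then \<open>y \<mapsto> y x\<close> embeds
  \<open>(0 : L') / (0 : L)\<close> into the socle, which is simple.\<close>

lemma ann_covers:
  assumes cov: "ideal_covers R L' L" and N: "ideal N R" "ann L \<subset> N" "N \<subseteq> ann L'"
  shows "N = ann L'"
proof
  note idL' = ideal_coversD(1)[OF cov] and idL = ideal_coversD(2)[OF cov]
  obtain x where x: "x \<in> L" "x \<notin> L'" using ideal_coversD(3,4)[OF cov] by blast
  have xc: "x \<in> carrier R" by (rule ideal.Icarr[OF idL x(1)])
  have ann_L: "y \<in> ann L" if "y \<in> ann L'" "y \<otimes> x = \<zero>" for y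
  proof -
    have yc: "y \<in> carrier R" using that by (simp add: annihilator_def)
    have "y \<otimes> (l \<oplus> r \<otimes> x) = \<zero>" if "l \<in> L'" "r \<in> carrier R" for l r
    proof -
      have "l \<in> carrier R" by (rule ideal.Icarr[OF idL' that(1)])
      moreover have "y \<otimes> l = \<zero>" using \<open>y \<in> ann L'\<close> that by (simp add: annihilator_def)
      moreover have "y \<otimes> (r \<otimes> x) = \<zero>"
        using yc that xc \<open>y \<otimes> x = \<zero>\<close> m_lcomm[of y r x] by simp
      ultimately show ?thesis using yc that xc by (simp add: r_distr)
    qed
    then have "y \<otimes> z = \<zero>" if "z \<in> L" for z
      using ideal_covers_generated[OF cov x that] by metis
    then show ?thesis using yc by (auto simp: annihilator_def)
  qed
  have soc: "y \<otimes> x \<in> ann m" if "y \<in> ann L'" for y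
  proof -
    have yc: "y \<in> carrier R" using that by (simp add: annihilator_def)
    have "(y \<otimes> x) \<otimes> a = \<zero>" if a: "a \<in> m" for a
    proof -
      have "y \<otimes> (a \<otimes> x) = \<zero>"
        using m_mult_covers[OF cov x(1) a] \<open>y \<in> ann L'\<close> by (simp add: annihilator_def)
      then show ?thesis using yc xc a m_subset by (metis m_assoc m_comm subsetD)
    qed
    then show ?thesis using yc xc by (simp add: annihilator_def)
  qed
  show "ann L' \<subseteq> N"
  proof
    fix z assume z: "z \<in> ann L'"
    obtain y where y: "y \<in> N" "y \<notin> ann L" using N by blast
    then have y': "y \<in> ann L'" using N by blast
    have c: "y \<in> carrier R" "z \<in> carrier R" using y' z by (auto simp: annihilator_def)
    have "y \<otimes> x \<noteq> \<zero>" using ann_L y y' by blast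
    \<comment> \<open>Both products lie in the socle, which the nonzero \<open>y \<otimes> x\<close>
      generates. Subtracting \<open>r \<otimes> y\<close> moves z into the kernel (0 : L), and N
      contains that.\<close>
    then obtain r where r: "r \<in> carrier R" "z \<otimes> x = r \<otimes> (y \<otimes> x)"
      using socle_generated soc y' z by metis
    have "(z \<ominus> r \<otimes> y) \<otimes> x = \<zero>"
      using r c xc by (simp add: a_minus_def l_distr l_minus m_assoc r_neg)
    moreover have "z \<ominus> r \<otimes> y \<in> ann L'"
      using ideal_diff[OF ann_ideal[OF idL'] z] ideal_mult[OF ann_ideal[OF idL'] y' r(1)] by simp
    ultimately have "z \<ominus> r \<otimes> y \<in> N" using ann_L N by blast
    moreover have "r \<otimes> y \<in> N" by (rule ideal_mult[OF N(1) y(1) r(1)])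
    ultimately have "(z \<ominus> r \<otimes> y) \<oplus> r \<otimes> y \<in> N" using ideal_add[OF N(1)] by simp
    then show "z \<in> N" using c r by (simp add: a_minus_def a_assoc l_neg)
  qed
qed (rule N)

text \<open>A minimal annihilator belongs to a maximal ideal among those between K and L, provided
  that annihilators are injective on the proper subideals of L. This is the hypothesis
  \<open>closed\<close>, kept separate because below a minimal counterexample to the double
  annihilator property only the proper subideals are known to satisfy it.\<close>

lemma covers_exists_if:
  assumes L: "ideal L R" "K \<subset> L" "ideal K R"
    and closed: "\<And>N. ideal N R \<Longrightarrow> N \<subset> L \<Longrightarrow> ann (ann N) = N"
  obtains L' where "ideal_covers R L' L" "K \<subseteq> L'"
proof -
  define S where "S = ann ` {N. ideal N R \<and> N \<subset> L \<and> K \<subseteq> N}"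
  have "S \<noteq> {}" using L by (auto simp: S_def)
  moreover have "ideal N R" if "N \<in> S" for N using that ann_ideal by (auto simp: S_def)
  ultimately have "\<exists>M\<in>S. \<forall>N'\<in>S. N' \<subseteq> M \<longrightarrow> N' = M" by (rule artinian_minimal[OF artinian])
  then obtain M where M: "M \<in> S" and min: "\<And>N'. N' \<in> S \<Longrightarrow> N' \<subseteq> M \<Longrightarrow> N' = M" by blast
  from M obtain L' where L': "ideal L' R" "L' \<subset> L" "K \<subseteq> L'" "M = ann L'" by (auto simp: S_def)
  have "N = L' \<or> N = L" if N: "ideal N R" "L' \<subseteq> N" "N \<subseteq> L" for N
  proof (rule disjCI)
    assume "N \<noteq> L"
    then have NL: "N \<subset> L" using N by blast
    then have "ann N \<in> S" using N L'(3) by (auto simp: S_def)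
    then have "ann N = ann L'" using min[of "ann N"] annihilator_antimono[OF N(2)] L'(4) by metis
    then show "N = L'" by (metis closed[OF N(1) NL] closed[OF L'(1,2)])
  qed
  then have "ideal_covers R L' L" using L L' by (auto simp: ideal_covers_def)
  then show thesis using that L' by blast
qed

text \<open>In a minimal counterexample \<open>L\<close>, choose \<open>L'\<close> with \<open>L / L'\<close> simple. The quotients
  \<open>(0 : L') / (0 : L)\<close> and hence \<open>(0 : (0 : L)) / (0 : (0 : L')) = (0 : (0 : L)) / L'\<close> have
  length at most one, and \<open>L \<subseteq> (0 : (0 : L))\<close>.\<close>

theorem ann_ann: "ideal L R \<Longrightarrow> ann (ann L) = L"
proof (rule ccontr)
  assume "ideal L R" "ann (ann L) \<noteq> L"
  moreover define S where "S = {N. ideal N R \<and> ann (ann N) \<noteq> N}"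
  ultimately have "S \<noteq> {}" by blast
  moreover have "ideal N R" if "N \<in> S" for N using that by (simp add: S_def)
  ultimately have "\<exists>M\<in>S. \<forall>N'\<in>S. N' \<subseteq> M \<longrightarrow> N' = M" by (rule artinian_minimal[OF artinian])
  then obtain M where MS: "M \<in> S" and min: "\<And>N'. N' \<in> S \<Longrightarrow> N' \<subseteq> M \<Longrightarrow> N' = M" by blast
  then have M: "ideal M R" "ann (ann M) \<noteq> M" by (simp_all add: S_def)
  have closed: "ann (ann N) = N" if "ideal N R" "N \<subset> M" for N
    using min[of N] that by (auto simp: S_def)
  \<comment> \<open>The zero ideal equals its double annihilator, so a counterexample is nonzero and
    has a cover below it.\<close>
  have "M \<noteq> {\<zero>}" using M(2) by (auto simp: annihilator_zero annihilator_carrier)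
  then have "{\<zero>} \<subset> M" using ideal_zero[OF M(1)] by blast
  then obtain L' where cov: "ideal_covers R L' M"
    using covers_exists_if[OF M(1) _ zeroideal closed] by metis
  note L' = ideal_coversD(1-4)[OF cov]
  have closed_L': "ann (ann L') = L'" using closed[OF L'(1)] L'(3,4) by simp
  have sub: "M \<subseteq> ann (ann M)" by (rule annihilator_annihilator_superset[OF ideal_subset[OF M(1)]])
  have le: "ann M \<subseteq> ann L'" by (rule annihilator_antimono[OF L'(3)])
  have "ann M \<noteq> ann L'" using closed_L' sub L' by auto
  then have "ideal_covers R (ann M) (ann L')"
    using ann_covers[OF cov] ann_ideal[OF M(1)] ann_ideal[OF L'(1)] le
    unfolding ideal_covers_def by blast
  from ann_covers[OF this M(1)] have "M = ann (ann M)"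
    using closed_L' L' sub by simp
  with M(2) show False by simp
qed

lemma ann_inj: "ideal L R \<Longrightarrow> ideal N R \<Longrightarrow> ann L = ann N \<Longrightarrow> L = N"
  using ann_ann by metis

lemma ann_strict: "ideal L R \<Longrightarrow> ideal N R \<Longrightarrow> L \<subset> N \<Longrightarrow> ann N \<subset> ann L"
  using ann_inj[of N L] annihilator_antimono[of L N] by blast

lemma covers_exists:
  assumes "ideal L R" "ideal K R" "K \<subset> L"
  obtains L' where "ideal_covers R L' L" "K \<subseteq> L'"
  using covers_exists_if[OF assms(1,3,2)] ann_ann by blast

text \<open>The annihilator of a nonzero L is proper, hence inside m; a second annihilator reverses
  this inclusion. The case of interest is L = I^u, the last nonzero power.\<close>

lemma socle_subset: "ann m \<subseteq> L" if L: "ideal L R" "L \<noteq> {\<zero>}"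
proof -
  have "ann L \<subseteq> m"
  proof (rule ccontr)
    assume "\<not> ann L \<subseteq> m"
    then have "ann L = carrier R" using ideal_eq_carrier ann_ideal[OF L(1)] by blast
    then show False using ann_ann[OF L(1)] annihilator_carrier L(2) by simp
  qed
  then show ?thesis using annihilator_antimono ann_ann[OF L(1)] by metis
qed

end

section \<open>Lengths of intervals of ideals\<close>

text \<open>The chain need not touch the ends of the interval, matching the supremum over all
  submodule chains in \<open>module_length\<close>.\<close>

definition ideal_chain ::
    "('a, 'b) ring_scheme \<Rightarrow> 'a set \<Rightarrow> 'a set \<Rightarrow> nat \<Rightarrow> (nat \<Rightarrow> 'a set) \<Rightarrow> bool" where
  "ideal_chain R lo hi n N \<longleftrightarrow>
     (\<forall>i\<le>n. ideal (N i) R \<and> lo \<subseteq> N i \<and> N i \<subseteq> hi) \<and> (\<forall>i<n. N i \<subset> N (Suc i))"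

text \<open>The length of the module hi / lo, read off in the lattice of ideals.\<close>

definition ideal_length :: "('a, 'b) ring_scheme \<Rightarrow> 'a set \<Rightarrow> 'a set \<Rightarrow> enat" where
  "ideal_length R lo hi = Sup {enat n | n. \<exists>N. ideal_chain R lo hi n N}"

lemma ideal_chainD:
  assumes "ideal_chain R lo hi n N" "i \<le> n"
  shows "ideal (N i) R" "lo \<subseteq> N i" "N i \<subseteq> hi"
  using assms by (auto simp: ideal_chain_def)

lemma ideal_chain_strict: "ideal_chain R lo hi n N \<Longrightarrow> i < n \<Longrightarrow> N i \<subset> N (Suc i)"
  by (simp add: ideal_chain_def)

lemma ideal_chain_mono:
  assumes "ideal_chain R lo hi n N" "i \<le> j" "j \<le> n"
  shows "N i \<subseteq> N j"
  using assms(2,3)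
proof (induction j rule: dec_induct)
  case (step k)
  then show ?case using ideal_chain_strict[OF assms(1), of k] by auto
qed auto

lemma ideal_chain_trivial:
  assumes "ideal_chain R lo hi n N" "\<not> lo \<subset> hi"
  shows "n = 0"
proof (rule ccontr)
  assume n: "n \<noteq> 0"
  have "lo \<subseteq> N 0" using ideal_chainD(2)[OF assms(1)] by simp
  also have "N 0 \<subset> N 1" using ideal_chain_strict[OF assms(1), of 0] n by simp
  also have "N 1 \<subseteq> hi" using ideal_chainD(3)[OF assms(1), of 1] n by simp
  finally show False using assms(2) by simp
qed

lemma ideal_length_self:
  assumes "\<not> lo \<subset> hi"
  shows "ideal_length R lo hi = 0"
proof -
  have "x \<le> 0" if "x \<in> {enat n | n. \<exists>N. ideal_chain R lo hi n N}" for x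
    using that ideal_chain_trivial[OF _ assms] by (auto simp: zero_enat_def)
  then have "ideal_length R lo hi \<le> 0"
    unfolding ideal_length_def by (rule Sup_least)
  then show ?thesis by simp
qed

context cring
begin

text \<open>An instance of the modular law: as P is not inside U, P + U = Y, and intersecting with U
  keeps P and Q apart. Concretely, q in Q outside P is reduced by a multiple of some p in P outside
  U to an element of U.\<close>

lemma covers_inter_strict:
  assumes cov: "ideal_covers R U Y"
    and P: "ideal P R" "\<not> P \<subseteq> U" and Q: "ideal Q R" "Q \<subseteq> Y" and PQ: "P \<subset> Q"
  shows "P \<inter> U \<subset> Q \<inter> U"
proof -
  obtain q where q: "q \<in> Q" "q \<notin> P" using PQ by blast
  obtain p where p: "p \<in> P" "p \<notin> U" using P by blast
  have "p \<in> Y" "q \<in> Y" using p q PQ Q(2) by auto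
  then obtain l r where l: "q = l \<oplus> r \<otimes> p" "l \<in> U" "r \<in> carrier R"
    using ideal_covers_generated[OF cov _ p(2)] by blast
  have rp: "r \<otimes> p \<in> P" by (rule ideal_mult[OF P(1) p(1) l(3)])
  have c: "l \<in> carrier R" "r \<otimes> p \<in> carrier R"
    using ideal.Icarr[OF ideal_coversD(1)[OF cov] l(2)] ideal.Icarr[OF P(1) rp] .
  have "q \<ominus> r \<otimes> p = l" using c l(1) by (simp add: a_minus_def a_assoc r_neg)
  moreover have "q \<ominus> r \<otimes> p \<in> Q" using ideal_diff[OF Q(1)] q(1) rp PQ by blast
  ultimately have "l \<in> Q" by simp
  moreover have "l \<notin> P" using ideal_add[OF P(1) _ rp, of l] l(1) q(2) by auto
  ultimately show ?thesis using PQ l(2) by blast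
qed

text \<open>Let j be the first index at which the chain leaves U. Keeping the members before j,
  deleting \<open>N j\<close> and intersecting the later ones with U produces a chain below U with
  one step less.\<close>

lemma ideal_chain_covers_bound:
  assumes cov: "ideal_covers R U Y"
    and bound: "\<And>n N. ideal_chain R lo U n N \<Longrightarrow> n \<le> b"
    and lo: "lo \<subseteq> U" and chain: "ideal_chain R lo Y n N"
  shows "n \<le> Suc b"
proof (cases "\<forall>i\<le>n. N i \<subseteq> U")
  case True
  then have "ideal_chain R lo U n N" using chain by (auto simp: ideal_chain_def)
  then show ?thesis using bound by fastforce
next
  case False
  note ch = ideal_chainD[OF chain] and strict = ideal_chain_strict[OF chain]
    and mono = ideal_chain_mono[OF chain]
  define j where "j = (LEAST j. \<not> N j \<subseteq> U)"
  obtain j' where j': "j' \<le> n" "\<not> N j' \<subseteq> U" using False by blast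
  have j: "\<not> N j \<subseteq> U" unfolding j_def by (rule LeastI[of "\<lambda>j. \<not> N j \<subseteq> U"], rule j'(2))
  have "j \<le> j'" unfolding j_def by (rule Least_le) (rule j'(2))
  then have jn: "j \<le> n" using j'(1) by simp
  have below: "N i \<subseteq> U" if "i < j" for i
    using not_less_Least[of i "\<lambda>j. \<not> N j \<subseteq> U"] that by (auto simp: j_def)
  have above: "\<not> N i \<subseteq> U" if "j \<le> i" "i \<le> n" for i
    using mono[OF that] j by blast
  have step: "N i \<inter> U \<subset> N (Suc i) \<inter> U" if "j \<le> i" "i < n" for i
    using that
    by (intro covers_inter_strict[OF cov]) (auto intro!: ch strict dest: above)
  have idX: "ideal U R" by (rule ideal_coversD[OF cov])
  show ?thesis
  proof (cases n)
    case (Suc k)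
    define N' where "N' i = (if i < j then N i else N (Suc i) \<inter> U)" for i
    have "ideal (N' i) R \<and> lo \<subseteq> N' i \<and> N' i \<subseteq> U" if "i \<le> k" for i
    proof (cases "i < j")
      case True
      then show ?thesis using that Suc ch[of i] below[of i] by (simp add: N'_def)
    next
      case False
      then show ?thesis
        using that Suc ch[of "Suc i"] lo i_intersect[OF _ idX, of "N (Suc i)"] by (simp add: N'_def)
    qed
    moreover have "N' i \<subset> N' (Suc i)" if "i < k" for i
    proof -
      consider "Suc i < j" | "Suc i = j" | "j \<le> i" by linarith
      then show ?thesis
      proof cases
        case 1
        then show ?thesis using strict[of i] that Suc by (simp add: N'_def)
      next
        case 2
        \<comment> \<open>Equality may occur here, which is why \<open>N j\<close> had to be
          deleted; strictness comes from the next inclusion.\<close>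
        have "N i \<subseteq> N j \<inter> U" using below[of i] strict[of i] 2 that Suc by auto
        also have "\<dots> \<subset> N (Suc j) \<inter> U" using step[of j] 2 that Suc by simp
        finally show ?thesis using 2 by (simp add: N'_def)
      next
        case 3
        then show ?thesis using step[of "Suc i"] that Suc by (simp add: N'_def)
      qed
    qed
    ultimately have "ideal_chain R lo U k N'" by (auto simp: ideal_chain_def)
    then show ?thesis using bound Suc by auto
  qed simp
qed

end

section \<open>Finite length and duality of lengths\<close>

context gorenstein_local
begin

text \<open>A minimal ideal with unbounded chains is nonzero, so it covers some U; chains below U
  are bounded by minimality, and a cover adds at most one step.\<close>

lemma ideal_chain_bounded:
  assumes "ideal Y R"
  shows "\<exists>b. \<forall>n N. ideal_chain R {\<zero>} Y n N \<longrightarrow> n \<le> b"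
proof (rule ccontr)
  assume "\<not> ?thesis"
  moreover define S where
    "S = {Y. ideal Y R \<and> \<not> (\<exists>b. \<forall>n N. ideal_chain R {\<zero>} Y n N \<longrightarrow> n \<le> b)}"
  ultimately have "S \<noteq> {}" using assms by blast
  moreover have "ideal N R" if "N \<in> S" for N using that by (simp add: S_def)
  ultimately have "\<exists>M\<in>S. \<forall>N'\<in>S. N' \<subseteq> M \<longrightarrow> N' = M" by (rule artinian_minimal[OF artinian])
  then obtain M where MS: "M \<in> S" and min: "\<And>N'. N' \<in> S \<Longrightarrow> N' \<subseteq> M \<Longrightarrow> N' = M" by blast
  have M: "ideal M R" and unbounded: "\<not> (\<exists>b. \<forall>n N. ideal_chain R {\<zero>} M n N \<longrightarrow> n \<le> b)"
    using MS by (simp_all add: S_def)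
  show False
  proof (cases "M = {\<zero>}")
    case True
    have "n \<le> 0" if "ideal_chain R {\<zero>} M n N" for n N
      using ideal_chain_trivial[OF that] True by simp
    then show False using unbounded by blast
  next
    case False
    then have "{\<zero>} \<subset> M" using ideal_zero[OF M] by blast
    then obtain U where cov: "ideal_covers R U M" by (rule covers_exists[OF M zeroideal])
    note U = ideal_coversD(1-4)[OF cov]
    have "U \<notin> S" using min[OF _ U(3)] U(4) by blast
    then obtain b where b: "\<And>n N. ideal_chain R {\<zero>} U n N \<Longrightarrow> n \<le> b"
      using U(1) unfolding S_def by blast
    have zU: "{\<zero>} \<subseteq> U" using ideal_zero[OF U(1)] by simp
    have "n \<le> Suc b" if "ideal_chain R {\<zero>} M n N" for n N
      by (rule ideal_chain_covers_bound[OF cov b zU that])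
    then show False using unbounded by blast
  qed
qed

text \<open>Prepending lo to a longest chain of the smaller interval gains a step. Boundedness of
  chains is essential: infinite values in \<open>enat\<close> would not be told apart.\<close>

lemma ideal_length_strict:
  assumes lo: "ideal lo R" and lo': "ideal lo' R" and hi: "ideal hi R"
    and less: "lo \<subset> lo'" and le: "lo' \<subseteq> hi"
  shows "ideal_length R lo' hi < ideal_length R lo hi"
proof -
  define E where "E = {n. \<exists>N. ideal_chain R lo' hi n N}"
  obtain b where b: "\<And>n N. ideal_chain R {\<zero>} hi n N \<Longrightarrow> n \<le> b"
    using ideal_chain_bounded[OF hi] by blast
  have "ideal_chain R {\<zero>} hi n N" if "ideal_chain R lo' hi n N" for n N
    using that ideal_zero by (simp add: ideal_chain_def)
  then have "E \<subseteq> {..b}" using b unfolding E_def by blast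
  then have fin: "finite E" by (rule finite_subset) simp
  have "ideal_chain R lo' hi 0 (\<lambda>_. lo')" using lo' le by (simp add: ideal_chain_def)
  then have "E \<noteq> {}" unfolding E_def by blast
  then have "Max E \<in> E" using fin by simp
  then obtain N where N: "ideal_chain R lo' hi (Max E) N" unfolding E_def by blast
  have "ideal_chain R lo hi (Suc (Max E)) (case_nat lo N)"
    unfolding ideal_chain_def
  proof (intro conjI allI impI)
    fix i assume i: "i \<le> Suc (Max E)"
    have "lo \<subseteq> hi" "lo \<subseteq> lo'" using less le by auto
    with i show "ideal (case i of 0 \<Rightarrow> lo | Suc i \<Rightarrow> N i) R" "lo \<subseteq> (case i of 0 \<Rightarrow> lo | Suc i \<Rightarrow> N i)"
      "(case i of 0 \<Rightarrow> lo | Suc i \<Rightarrow> N i) \<subseteq> hi"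
      using lo ideal_chainD[OF N] subset_trans[of lo lo'] by (cases i; simp)+
  next
    fix i assume "i < Suc (Max E)"
    then show "(case i of 0 \<Rightarrow> lo | Suc i \<Rightarrow> N i) \<subset> (case Suc i of 0 \<Rightarrow> lo | Suc i \<Rightarrow> N i)"
      using psubset_subset_trans[OF less ideal_chainD(2)[OF N, of 0]] ideal_chain_strict[OF N]
      by (cases i) simp_all
  qed
  then have "enat (Suc (Max E)) \<le> ideal_length R lo hi"
    unfolding ideal_length_def by (intro Sup_upper) blast
  moreover have "x \<le> enat (Max E)" if x: "x \<in> {enat n | n. \<exists>N. ideal_chain R lo' hi n N}" for x
  proof -
    from x obtain n where "x = enat n" "n \<in> E" unfolding E_def by blast
    then show ?thesis using Max_ge[OF fin] by simp
  qed
  then have "ideal_length R lo' hi \<le> enat (Max E)"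
    unfolding ideal_length_def by (rule Sup_least)
  moreover have "enat (Max E) < enat (Suc (Max E))" by simp
  ultimately show ?thesis by (meson le_less_trans less_le_trans)
qed

lemma ideal_chain_ann:
  assumes "ideal_chain R lo hi n N"
  shows "ideal_chain R (ann hi) (ann lo) n (\<lambda>i. ann (N (n - i)))"
  unfolding ideal_chain_def
proof (intro conjI allI impI)
  fix i assume "i \<le> n"
  note N = ideal_chainD[OF assms, of "n - i"]
  show "ideal (ann (N (n - i))) R" using N ann_ideal by simp
  show "ann hi \<subseteq> ann (N (n - i))" "ann (N (n - i)) \<subseteq> ann lo"
    using N annihilator_antimono by simp_all
next
  fix i assume i: "i < n"
  then have "N (n - Suc i) \<subset> N (n - i)"
    using ideal_chain_strict[OF assms, of "n - Suc i"] by (simp add: Suc_diff_Suc)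
  then show "ann (N (n - i)) \<subset> ann (N (n - Suc i))"
    by (intro ann_strict ideal_chainD[OF assms]) auto
qed

lemma ideal_length_ann_le: "ideal_length R lo hi \<le> ideal_length R (ann hi) (ann lo)"
  unfolding ideal_length_def by (rule Sup_subset_mono) (blast dest: ideal_chain_ann)

text \<open>The inequality applied to the dual interval gives its own converse, since double
  annihilators return the original ends.\<close>

lemma ideal_length_ann:
  assumes "ideal lo R" "ideal hi R"
  shows "ideal_length R (ann hi) (ann lo) = ideal_length R lo hi"
  using ideal_length_ann_le[of lo hi] ideal_length_ann_le[of "ann hi" "ann lo"] ann_ann assms
  by (simp add: antisym)

end

section \<open>Powers of an ideal and the Hilbert function\<close>

text \<open>Here \<open>rcoset_mult\<close> multiplies cosets of two ideals P and Q into cosets of a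
  third one, J, as the product of graded pieces demands. The three product conditions make the
  result independent of the representatives.\<close>

lemma (in cring) rcoset_mult_cosets:
  assumes J: "ideal J R" and P: "ideal P R" and Q: "ideal Q R"
    and x: "x \<in> carrier R" and y: "y \<in> carrier R"
    and Py: "\<And>p. p \<in> P \<Longrightarrow> p \<otimes> y \<in> J"
    and xQ: "\<And>q. q \<in> Q \<Longrightarrow> x \<otimes> q \<in> J"
    and PQ: "\<And>p q. p \<in> P \<Longrightarrow> q \<in> Q \<Longrightarrow> p \<otimes> q \<in> J"
  shows "rcoset_mult R J (P +> x) (Q +> y) = J +> (x \<otimes> y)"
proof -
  have "J +> (a \<otimes> b) = J +> (x \<otimes> y)" if ab: "a \<in> P +> x" "b \<in> Q +> y" for a b
  proof -
    obtain p where p: "p \<in> P" "a = p \<oplus> x" using ab(1) by (auto simp: a_r_coset_def')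
    obtain q where q: "q \<in> Q" "b = q \<oplus> y" using ab(2) by (auto simp: a_r_coset_def')
    have c: "p \<in> carrier R" "q \<in> carrier R" using ideal.Icarr P Q p(1) q(1) by metis+
    have "a \<otimes> b = (p \<otimes> q \<oplus> (p \<otimes> y \<oplus> x \<otimes> q)) \<oplus> x \<otimes> y"
      using p q c x y by (simp add: l_distr r_distr a_ac)
    then have "a \<otimes> b \<ominus> x \<otimes> y = p \<otimes> q \<oplus> (p \<otimes> y \<oplus> x \<otimes> q)"
      using c x y by (simp add: a_minus_def a_assoc r_neg)
    also have "\<dots> \<in> J"
      using ideal_add[OF J PQ[OF p(1) q(1)] ideal_add[OF J Py[OF p(1)] xQ[OF q(1)]]] .
    finally show ?thesis
      using quotient_eq_iff_same_a_r_cos[OF J] p q c x y by simp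
  qed
  moreover have "x \<in> P +> x" "y \<in> Q +> y"
    using x y ideal_zero[OF P] ideal_zero[OF Q] by (force simp: a_r_coset_def')+
  ultimately show ?thesis unfolding rcoset_mult_def by blast
qed

locale graded_ideal = cring R for R (structure) +
  fixes I :: "'a set"
  assumes I_ideal: "ideal I R"
begin

abbreviation pw where "pw \<equiv> ideal_pow R I"
abbreviation cls where "cls \<equiv> gr_class R I"
abbreviation G where "G \<equiv> gr_ring R I"

lemma pw_0: "pw 0 = carrier R"
  by (simp add: ideal_pow_def ideals_set_def)

lemma pw_ideal: "ideal (pw n) R"
proof -
  interpret M: comm_monoid "ideals_set R" by (rule ideals_set_is_comm_monoid)
  have "I [^]\<^bsub>ideals_set R\<^esub> n \<in> carrier (ideals_set R)"
    using I_ideal by (intro M.nat_pow_closed) (simp add: ideals_set_def)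
  then show ?thesis by (simp add: ideal_pow_def ideals_set_def)
qed

lemma pw_add: "pw (i + j) = ideal_prod R (pw i) (pw j)"
proof -
  interpret M: comm_monoid "ideals_set R" by (rule ideals_set_is_comm_monoid)
  have "I \<in> carrier (ideals_set R)" using I_ideal by (simp add: ideals_set_def)
  from M.nat_pow_mult[OF this, of i j] show ?thesis
    by (simp add: ideal_pow_def ideals_set_def)
qed

lemma pw_1: "pw 1 = I"
proof -
  interpret M: comm_monoid "ideals_set R" by (rule ideals_set_is_comm_monoid)
  have "I \<in> carrier (ideals_set R)" using I_ideal by (simp add: ideals_set_def)
  then show ?thesis by (simp add: ideal_pow_def)
qed

lemma pw_mult: "x \<in> pw i \<Longrightarrow> y \<in> pw j \<Longrightarrow> x \<otimes> y \<in> pw (i + j)"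
  unfolding pw_add by (rule ideal_prod.prod)

lemma pw_add_subsetI:
  assumes "ideal N R" "\<And>x y. x \<in> pw i \<Longrightarrow> y \<in> pw j \<Longrightarrow> x \<otimes> y \<in> N"
  shows "pw (i + j) \<subseteq> N"
proof
  fix z assume "z \<in> pw (i + j)"
  then show "z \<in> N"
    unfolding pw_add by (induction z rule: ideal_prod.induct) (use assms ideal_add in auto)
qed

lemma pw_closed [intro]: "x \<in> pw n \<Longrightarrow> x \<in> carrier R"
  by (rule ideal.Icarr[OF pw_ideal])

lemma pw_antimono: "i \<le> j \<Longrightarrow> pw j \<subseteq> pw i"
proof -
  have "pw (i + k) \<subseteq> pw i" for k
    using ideal_mult[OF pw_ideal] by (intro pw_add_subsetI pw_ideal) (metis m_comm pw_closed)
  then show "i \<le> j \<Longrightarrow> pw j \<subseteq> pw i" by (metis le_add_diff_inverse)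
qed

lemma pw_SucD: "x \<in> pw (Suc n) \<Longrightarrow> x \<in> pw n"
  using pw_antimono[of n "Suc n"] by auto

lemma pw_mult_left: "x \<in> carrier R \<Longrightarrow> y \<in> pw n \<Longrightarrow> x \<otimes> y \<in> pw n"
  by (rule ideal_mult[OF pw_ideal])

lemma cls_eq_iff: "x \<in> carrier R \<Longrightarrow> y \<in> carrier R \<Longrightarrow> cls n x = cls n y \<longleftrightarrow> x \<ominus> y \<in> pw (Suc n)"
  unfolding gr_class_def using quotient_eq_iff_same_a_r_cos[OF pw_ideal] by simp

lemma cls_zero: "cls n \<zero> = pw (Suc n)"
  unfolding gr_class_def by (rule a_rcos_zero[OF pw_ideal ideal_zero[OF pw_ideal]])

lemma cls_eq_zero_iff: "x \<in> carrier R \<Longrightarrow> cls n x = pw (Suc n) \<longleftrightarrow> x \<in> pw (Suc n)"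
  using cls_eq_iff[of x \<zero> n] by (simp add: cls_zero a_minus_def)

lemma cls_add: "x \<in> carrier R \<Longrightarrow> y \<in> carrier R \<Longrightarrow> cls n x <+> cls n y = cls n (x \<oplus> y)"
  unfolding gr_class_def by (rule ideal.a_rcos_sum[OF pw_ideal])

lemma cls_mult:
  assumes "x \<in> pw i" "y \<in> pw j"
  shows "rcoset_mult R (pw (Suc (i + j))) (cls i x) (cls j y) = cls (i + j) (x \<otimes> y)"
  unfolding gr_class_def
proof (rule rcoset_mult_cosets[OF pw_ideal pw_ideal pw_ideal])
  show "p \<otimes> y \<in> pw (Suc (i + j))" if "p \<in> pw (Suc i)" for p
    using pw_mult[OF that assms(2)] by simp
  show "x \<otimes> q \<in> pw (Suc (i + j))" if "q \<in> pw (Suc j)" for q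
    using pw_mult[OF assms(1) that] by simp
  show "p \<otimes> q \<in> pw (Suc (i + j))" if "p \<in> pw (Suc i)" "q \<in> pw (Suc j)" for p q
    using pw_mult[OF pw_SucD[OF that(1)] that(2)] by simp
qed (use assms in auto)

text \<open>The coset of a modulo I is the class of a in degree 0, so the scalar action is a product
  of graded pieces with i = 0.\<close>

lemma cls_smult:
  assumes "a \<in> carrier R" "x \<in> pw n"
  shows "rcoset_mult R (pw (Suc n)) (I +> a) (cls n x) = cls n (a \<otimes> x)"
  using cls_mult[of a 0 x n] assms by (simp add: pw_0 gr_class_def pw_1[unfolded One_nat_def])

abbreviation V where "V \<equiv> gr_module R I"

lemma V_simps:
  "carrier (V n) = cls n ` pw n" "\<zero>\<^bsub>V n\<^esub> = pw (Suc n)"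
  "x \<oplus>\<^bsub>V n\<^esub> y = x <+> y" "s \<odot>\<^bsub>V n\<^esub> x = rcoset_mult R (pw (Suc n)) s x"
  by (simp_all add: gr_module_def)

lemma V_group: "group (add_monoid (V n))"
proof (rule groupI)
  fix x y z
  assume "x \<in> carrier (add_monoid (V n))" "y \<in> carrier (add_monoid (V n))"
    "z \<in> carrier (add_monoid (V n))"
  then obtain a b c where abc: "a \<in> pw n" "b \<in> pw n" "c \<in> pw n"
    and [simp]: "x = cls n a" "y = cls n b" "z = cls n c" by (auto simp: V_simps)
  have [simp]: "a \<in> carrier R" "b \<in> carrier R" "c \<in> carrier R" using abc by auto
  show "x \<otimes>\<^bsub>add_monoid (V n)\<^esub> y \<in> carrier (add_monoid (V n))"
    using abc ideal_add[OF pw_ideal] by (simp add: V_simps cls_add)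
  show "x \<otimes>\<^bsub>add_monoid (V n)\<^esub> y \<otimes>\<^bsub>add_monoid (V n)\<^esub> z =
      x \<otimes>\<^bsub>add_monoid (V n)\<^esub> (y \<otimes>\<^bsub>add_monoid (V n)\<^esub> z)"
    by (simp add: V_simps cls_add a_assoc)
  show "\<one>\<^bsub>add_monoid (V n)\<^esub> \<otimes>\<^bsub>add_monoid (V n)\<^esub> x = x"
    by (simp add: V_simps cls_add flip: cls_zero)
  have "cls n (\<ominus> a) \<otimes>\<^bsub>add_monoid (V n)\<^esub> x = \<one>\<^bsub>add_monoid (V n)\<^esub>"
    by (simp add: V_simps cls_add l_neg cls_zero)
  moreover have "cls n (\<ominus> a) \<in> carrier (add_monoid (V n))"
    using abc ideal_minus[OF pw_ideal] by (simp add: V_simps)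
  ultimately show "\<exists>y\<in>carrier (add_monoid (V n)). y \<otimes>\<^bsub>add_monoid (V n)\<^esub> x = \<one>\<^bsub>add_monoid (V n)\<^esub>"
    by blast
next
  show "\<one>\<^bsub>add_monoid (V n)\<^esub> \<in> carrier (add_monoid (V n))"
    using ideal_zero[OF pw_ideal] by (auto simp: V_simps simp flip: cls_zero)
qed

lemma V_inv: "x \<in> pw n \<Longrightarrow> inv\<^bsub>add_monoid (V n)\<^esub> (cls n x) = cls n (\<ominus> x)"
  using ideal_minus[OF pw_ideal, of x n] pw_closed[of x n]
  by (intro group.inv_equality[OF V_group]) (simp_all add: V_simps cls_add l_neg cls_zero)

lemma quot_carrierE:
  assumes "s \<in> carrier (R Quot I)" obtains r where "r \<in> carrier R" "s = I +> r"
  using assms by (auto simp: FactRing_simps)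

lemma submodule_image:
  assumes N: "ideal N R" "N \<subseteq> pw n"
  shows "submodule (cls n ` N) (R Quot I) (V n)"
proof (intro submodule.intro submodule_axioms.intro)
  note c = ideal.Icarr[OF N(1)]
  show "subgroup (cls n ` N) (add_monoid (V n))"
  proof (rule group.subgroupI[OF V_group])
    show "cls n ` N \<subseteq> carrier (add_monoid (V n))" using N(2) by (auto simp: V_simps)
    show "cls n ` N \<noteq> {}" using ideal_zero[OF N(1)] by auto
    show "inv\<^bsub>add_monoid (V n)\<^esub> a \<in> cls n ` N" if "a \<in> cls n ` N" for a
      using that N V_inv ideal_minus[OF N(1)] by auto
    show "a \<otimes>\<^bsub>add_monoid (V n)\<^esub> b \<in> cls n ` N" if "a \<in> cls n ` N" "b \<in> cls n ` N" for a b
      using that c ideal_add[OF N(1)] by (auto simp: V_simps cls_add)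
  qed
  show "a \<odot>\<^bsub>V n\<^esub> x \<in> cls n ` N" if a: "a \<in> carrier (R Quot I)" and x: "x \<in> cls n ` N" for a x
  proof -
    obtain r where r: "r \<in> carrier R" "a = I +> r" by (rule quot_carrierE[OF a])
    moreover obtain y where y: "y \<in> N" "x = cls n y" using x by blast
    moreover have "y \<in> pw n" using y(1) N(2) by auto
    ultimately have "a \<odot>\<^bsub>V n\<^esub> x = cls n (r \<otimes> y)" by (simp add: V_simps cls_smult)
    then show ?thesis using ideal_mult[OF N(1) y(1) r(1)] by simp
  qed
qed

lemma submodule_vimage:
  assumes S: "submodule S (R Quot I) (V n)"
  shows "ideal {x \<in> pw n. cls n x \<in> S} R" "pw (Suc n) \<subseteq> {x \<in> pw n. cls n x \<in> S}"
    "S \<subseteq> cls n ` {x \<in> pw n. cls n x \<in> S}"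
proof -
  let ?N = "{x \<in> pw n. cls n x \<in> S}"
  have sg: "subgroup S (add_monoid (V n))" using S by (rule submodule.axioms)
  have sm: "a \<odot>\<^bsub>V n\<^esub> x \<in> S" if "a \<in> carrier (R Quot I)" "x \<in> S" for a x
    using submodule.smult_closed[OF S that] .
  have zero: "pw (Suc n) \<in> S" using subgroup.one_closed[OF sg] by (simp add: V_simps)
  have mult: "r \<otimes> x \<in> ?N" if "x \<in> ?N" "r \<in> carrier R" for r x
    using that sm[of "I +> r" "cls n x"]
    by (auto simp: FactRing_simps V_simps cls_smult pw_mult_left)
  show "ideal ?N R"
  proof (rule idealI)
    show "ring R" by (rule ring_axioms)
    show "subgroup ?N (add_monoid R)"
    proof (rule add.subgroupI)
      show "?N \<subseteq> carrier R" by auto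
      show "?N \<noteq> {}" using zero ideal_zero[OF pw_ideal] by (auto simp flip: cls_zero)
      show "\<ominus> a \<in> ?N" if "a \<in> ?N" for a
        using that subgroup.m_inv_closed[OF sg, of "cls n a"] V_inv ideal_minus[OF pw_ideal]
        by auto
      show "a \<oplus> b \<in> ?N" if "a \<in> ?N" "b \<in> ?N" for a b
        using that subgroup.m_closed[OF sg, of "cls n a" "cls n b"] ideal_add[OF pw_ideal]
        by (auto simp: V_simps cls_add pw_closed)
    qed
    show "x \<otimes> a \<in> ?N" "a \<otimes> x \<in> ?N" if "a \<in> ?N" "x \<in> carrier R" for a x
      using mult[OF that] m_comm[of a x] that pw_closed[of a n] by auto
  qed
  show "pw (Suc n) \<subseteq> ?N"
    using zero pw_SucD cls_eq_zero_iff pw_closed by (metis (no_types, lifting) mem_Collect_eq subsetI)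
  show "S \<subseteq> cls n ` ?N" using subgroup.subset[OF sg] by (auto simp: V_simps)
qed

text \<open>The correspondence theorem for chains: images and preimages exchange submodules of I^n /
  I^(n+1) over the quotient by I with ideals between I^(n+1) and I^n, and both directions keep
  strict inclusions strict.\<close>

lemma gr_HF_eq: "gr_HF R I (int n) = ideal_length R (pw (Suc n)) (pw n)"
proof -
  have "(\<exists>N. (\<forall>i\<le>k. submodule (N i) (R Quot I) (V n)) \<and> (\<forall>i<k. N i \<subset> N (Suc i))) \<longleftrightarrow>
    (\<exists>N. ideal_chain R (pw (Suc n)) (pw n) k N)" for k
  proof
    assume "\<exists>N. (\<forall>i\<le>k. submodule (N i) (R Quot I) (V n)) \<and> (\<forall>i<k. N i \<subset> N (Suc i))"
    then obtain N where N: "\<And>i. i \<le> k \<Longrightarrow> submodule (N i) (R Quot I) (V n)"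
      and strict: "\<And>i. i < k \<Longrightarrow> N i \<subset> N (Suc i)" by blast
    let ?M = "\<lambda>i. {x \<in> pw n. cls n x \<in> N i}"
    have "?M i \<subset> ?M (Suc i)" if "i < k" for i
    proof -
      have "N (Suc i) \<subseteq> cls n ` ?M (Suc i)" using submodule_vimage(3) N that by simp
      then show ?thesis using strict[OF that] by blast
    qed
    then have "ideal_chain R (pw (Suc n)) (pw n) k ?M"
      using submodule_vimage(1,2)[OF N] by (auto simp: ideal_chain_def)
    then show "\<exists>N. ideal_chain R (pw (Suc n)) (pw n) k N" by blast
  next
    assume "\<exists>N. ideal_chain R (pw (Suc n)) (pw n) k N"
    then obtain N where N: "ideal_chain R (pw (Suc n)) (pw n) k N" by blast
    have "cls n ` N i \<subset> cls n ` N (Suc i)" if i: "i < k" for i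
    proof -
      have idN: "ideal (N i) R" and lo: "pw (Suc n) \<subseteq> N i" and hi: "N (Suc i) \<subseteq> pw n"
        using ideal_chainD[OF N] i by auto
      obtain x where x: "x \<in> N (Suc i)" "x \<notin> N i" using ideal_chain_strict[OF N i] by blast
      have xc: "x \<in> carrier R" using x(1) hi by auto
      have "cls n x \<noteq> cls n y" if y: "y \<in> N i" for y
      proof
        assume eq: "cls n x = cls n y"
        have yc: "y \<in> carrier R" by (rule ideal.Icarr[OF idN y])
        \<comment> \<open>As \<open>N i\<close> contains I^(n+1), it is a union of cosets, so
          equality of classes would carry x into it.\<close>
        have "x \<ominus> y \<in> N i" using eq cls_eq_iff[OF xc yc] lo by blast
        then have "(x \<ominus> y) \<oplus> y \<in> N i" using ideal_add[OF idN _ y] by simp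
        then show False using x(2) xc yc by (simp add: a_minus_def a_assoc l_neg)
      qed
      then have "cls n x \<notin> cls n ` N i" by blast
      then show ?thesis using x(1) ideal_chain_strict[OF N i] by blast
    qed
    moreover have "submodule (cls n ` N i) (R Quot I) (V n)" if "i \<le> k" for i
      using ideal_chainD[OF N that] submodule_image by simp
    ultimately show "\<exists>N. (\<forall>i\<le>k. submodule (N i) (R Quot I) (V n)) \<and> (\<forall>i<k. N i \<subset> N (Suc i))"
      by (intro exI[of _ "\<lambda>i. cls n ` N i"]) simp
  qed
  then show ?thesis by (simp add: gr_HF_def module_length_def ideal_length_def)
qed

end

section \<open>The associated graded ring\<close>

lemma (in cring) ideal_finsum:
  assumes N: "ideal N R" and f: "\<And>i. i \<in> A \<Longrightarrow> f i \<in> N"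
  shows "finsum R f A \<in> N"
  using f
proof (induction A rule: infinite_finite_induct)
  case (insert a A)
  have "f \<in> insert a A \<rightarrow> carrier R" using insert.prems ideal.Icarr[OF N] by blast
  then have "finsum R f (insert a A) = f a \<oplus> finsum R f A"
    using insert.hyps by (intro finsum_insert) auto
  then show ?case using insert by (simp add: ideal_add[OF N])
qed (use ideal_zero[OF N] in auto)

context graded_ideal
begin

text \<open>The Rees algebra of I: polynomials whose n-th coefficient lies in I^n.\<close>

definition seqs :: "(nat \<Rightarrow> 'a) set" where
  "seqs = {p \<in> carrier (UP R). \<forall>n. p n \<in> pw n}"

definition gr :: "(nat \<Rightarrow> 'a) \<Rightarrow> nat \<Rightarrow> 'a set" where
  "gr p = (\<lambda>n. cls n (p n))"

text \<open>The monomial x t^i.\<close>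

definition single :: "nat \<Rightarrow> 'a \<Rightarrow> nat \<Rightarrow> 'a" where
  "single i x = (\<lambda>n. if n = i then x else \<zero>)"

lemma seqs_pw: "p \<in> seqs \<Longrightarrow> p n \<in> pw n"
  by (simp add: seqs_def)

lemma seqs_closed: "p \<in> seqs \<Longrightarrow> p n \<in> carrier R"
  using seqs_pw by blast

lemma seqsI: "(\<And>n. p n \<in> pw n) \<Longrightarrow> bound \<zero> b p \<Longrightarrow> p \<in> seqs"
  by (auto simp: seqs_def UP_def)

lemma seqs_bound: "p \<in> seqs \<Longrightarrow> \<exists>b. bound \<zero> b p"
  by (auto simp: seqs_def UP_def)

lemma UP_simps:
  "p \<in> seqs \<Longrightarrow> q \<in> seqs \<Longrightarrow> p \<oplus>\<^bsub>UP R\<^esub> q = (\<lambda>n. p n \<oplus> q n)"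
  "p \<in> seqs \<Longrightarrow> q \<in> seqs \<Longrightarrow> p \<otimes>\<^bsub>UP R\<^esub> q = (\<lambda>n. \<Oplus>i\<in>{..n}. p i \<otimes> q (n - i))"
  "\<one>\<^bsub>UP R\<^esub> = single 0 \<one>" "\<zero>\<^bsub>UP R\<^esub> = (\<lambda>n. \<zero>)"
  by (auto simp: seqs_def UP_def single_def)

lemma single_seqs: "x \<in> pw i \<Longrightarrow> single i x \<in> seqs"
  using ideal_zero[OF pw_ideal] by (intro seqsI[of _ i]) (auto simp: single_def)

lemma zero_seqs: "(\<lambda>n. \<zero>) \<in> seqs"
  using ideal_zero[OF pw_ideal] by (intro seqsI[of _ 0]) auto

lemma UP_coeff: "p \<in> carrier (UP R) \<Longrightarrow> up_ring.coeff (UP R) p n = p n"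
  by (simp add: UP_def)

lemma seqs_subring: "subring seqs (UP R)"
proof -
  interpret P: UP_cring R "UP R" by unfold_locales
  show ?thesis
  proof (rule P.subringI)
    show "seqs \<subseteq> carrier (UP R)" by (auto simp: seqs_def)
    show "\<one>\<^bsub>UP R\<^esub> \<in> seqs" using single_seqs[of \<one> 0] by (simp add: UP_simps pw_0)
  next
    fix p assume p: "p \<in> seqs"
    then have pc: "p \<in> carrier (UP R)" by (simp add: seqs_def)
    have "(\<ominus>\<^bsub>UP R\<^esub> p) n = \<ominus> p n" for n
      using P.coeff_a_inv[OF pc, of n]
      unfolding UP_coeff[OF pc] UP_coeff[OF P.UP_a_inv_closed[OF pc]] .
    then show "\<ominus>\<^bsub>UP R\<^esub> p \<in> seqs"
      using p ideal_minus[OF pw_ideal] P.UP_a_inv_closed[OF pc] by (simp add: seqs_def)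
  next
    fix p q assume pq: "p \<in> seqs" "q \<in> seqs"
    then have c: "p \<in> carrier (UP R)" "q \<in> carrier (UP R)" by (simp_all add: seqs_def)
    have pw: "p i \<otimes> q (n - i) \<in> pw n" if "i \<in> {..n}" for i n
      using pw_mult[OF seqs_pw[OF pq(1), of i] seqs_pw[OF pq(2), of "n - i"]] that by simp
    have "(p \<otimes>\<^bsub>UP R\<^esub> q) n \<in> pw n" for n
      unfolding UP_simps(2)[OF pq] by (rule ideal_finsum[OF pw_ideal pw])
    then show "p \<otimes>\<^bsub>UP R\<^esub> q \<in> seqs" using P.UP_mult_closed[OF c] by (simp add: seqs_def)
    have "(p \<oplus>\<^bsub>UP R\<^esub> q) n \<in> pw n" for n
      using UP_simps(1)[OF pq] ideal_add[OF pw_ideal] pq by (simp add: seqs_pw)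
    then show "p \<oplus>\<^bsub>UP R\<^esub> q \<in> seqs" using P.UP_a_closed[OF c] by (simp add: seqs_def)
  qed
qed

lemma G_simps:
  "\<zero>\<^bsub>G\<^esub> = (\<lambda>n. pw (Suc n))" "\<one>\<^bsub>G\<^esub> = gr (single 0 \<one>)" "f \<oplus>\<^bsub>G\<^esub> g = (\<lambda>n. f n <+> g n)"
  by (simp_all add: gr_ring_def gr_const_def gr_def single_def)

lemma gr_zero: "gr (\<lambda>n. \<zero>) = \<zero>\<^bsub>G\<^esub>"
  by (simp add: gr_def G_simps cls_zero)

lemma gr_add: "p \<in> seqs \<Longrightarrow> q \<in> seqs \<Longrightarrow> gr p \<oplus>\<^bsub>G\<^esub> gr q = gr (\<lambda>n. p n \<oplus> q n)"
  by (simp add: gr_def G_simps cls_add seqs_closed)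

lemma cls_finsum:
  assumes "f \<in> A \<rightarrow> carrier R"
  shows "finsum (R Quot pw (Suc n)) (\<lambda>i. cls n (f i)) A = cls n (finsum R f A)"
  using ring_hom_cring.hom_finsum[OF ideal.rcos_ring_hom_cring[OF pw_ideal cring_axioms] assms]
  by (simp add: gr_class_def comp_def)

text \<open>The product of G(I) multiplies cosets of different powers and adds modulo I^(n+1). Once
  \<open>cls_mult\<close> has rewritten each product as a coset of I^(n+1), the quotient map
  commutes with the sum.\<close>

lemma gr_mult:
  assumes "p \<in> seqs" "q \<in> seqs"
  shows "gr p \<otimes>\<^bsub>G\<^esub> gr q = gr (\<lambda>n. \<Oplus>i\<in>{..n}. p i \<otimes> q (n - i))"
proof
  fix n
  interpret Q: ring "R Quot pw (Suc n)" by (rule ideal.quotient_is_ring[OF pw_ideal])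
  have "(gr p \<otimes>\<^bsub>G\<^esub> gr q) n =
      finsum (R Quot pw (Suc n)) (\<lambda>i. rcoset_mult R (pw (Suc n)) (cls i (p i)) (cls (n - i) (q (n - i)))) {..n}"
    by (simp add: gr_ring_def gr_def)
  also have "\<dots> = finsum (R Quot pw (Suc n)) (\<lambda>i. cls n (p i \<otimes> q (n - i))) {..n}"
  proof (rule Q.finsum_cong')
    show "(\<lambda>i. cls n (p i \<otimes> q (n - i))) \<in> {..n} \<rightarrow> carrier (R Quot pw (Suc n))"
      using ring_hom_closed[OF ideal.rcos_ring_hom[OF pw_ideal]] seqs_closed assms
      by (simp add: gr_class_def)
    show "rcoset_mult R (pw (Suc n)) (cls i (p i)) (cls (n - i) (q (n - i))) = cls n (p i \<otimes> q (n - i))"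
      if "i \<in> {..n}" for i
      using cls_mult[OF seqs_pw[OF assms(1), of i] seqs_pw[OF assms(2), of "n - i"]] that by simp
  qed simp
  also have "\<dots> = cls n (\<Oplus>i\<in>{..n}. p i \<otimes> q (n - i))"
    using seqs_closed assms by (intro cls_finsum) auto
  finally show "(gr p \<otimes>\<^bsub>G\<^esub> gr q) n = gr (\<lambda>n. \<Oplus>i\<in>{..n}. p i \<otimes> q (n - i)) n"
    by (simp add: gr_def)
qed

lemma G_carrier: "carrier G = gr ` seqs"
proof (intro equalityI subsetI)
  fix f assume "f \<in> carrier G"
  then have f: "\<And>n. f n \<in> cls n ` pw n" and fin: "finite {n. f n \<noteq> pw (Suc n)}"
    by (auto simp: gr_ring_def)
  \<comment> \<open>The zero class must be represented by 0: other choices could have infinite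
    support and fail to be a polynomial.\<close>
  have "\<exists>x. x \<in> pw n \<and> f n = cls n x \<and> (f n = pw (Suc n) \<longrightarrow> x = \<zero>)" for n
  proof (cases "f n = pw (Suc n)")
    case True
    then show ?thesis using ideal_zero[OF pw_ideal] cls_zero by auto
  next
    case False
    then show ?thesis using f[of n] by auto
  qed
  then obtain p where p: "\<And>n. p n \<in> pw n" "\<And>n. f n = cls n (p n)"
    "\<And>n. f n = pw (Suc n) \<Longrightarrow> p n = \<zero>" by metis
  obtain b where "{n. f n \<noteq> pw (Suc n)} \<subseteq> {..b}" using finite_nat_iff_bounded_le fin by auto
  then have "bound \<zero> b p" using p(3) by (intro bound.intro) fastforce
  then have "p \<in> seqs" using p(1) seqsI by blast
  moreover have "f = gr p" using p(2) by (auto simp: gr_def)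
  ultimately show "f \<in> gr ` seqs" by blast
next
  fix f assume "f \<in> gr ` seqs"
  then obtain p where p: "p \<in> seqs" "f = gr p" by blast
  obtain b where b: "bound \<zero> b p" using seqs_bound[OF p(1)] by blast
  have "{n. f n \<noteq> pw (Suc n)} \<subseteq> {..b}"
  proof
    fix n assume "n \<in> {n. f n \<noteq> pw (Suc n)}"
    then have "p n \<noteq> \<zero>" using p(2) cls_zero by (auto simp: gr_def)
    then show "n \<in> {..b}" using bound_below[OF b] by simp
  qed
  then have "finite {n. f n \<noteq> pw (Suc n)}" by (rule finite_subset) simp
  moreover have "\<forall>n. f n \<in> cls n ` pw n" using p seqs_pw by (auto simp: gr_def)
  ultimately show "f \<in> carrier G" by (simp add: gr_ring_def)
qed

lemma seqs_add: "p \<in> seqs \<Longrightarrow> q \<in> seqs \<Longrightarrow> (\<lambda>n. p n \<oplus> q n) \<in> seqs"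
  using subringE(7)[OF seqs_subring, of p q] UP_simps(1) by simp

lemma seqs_mult: "p \<in> seqs \<Longrightarrow> q \<in> seqs \<Longrightarrow> (\<lambda>n. \<Oplus>i\<in>{..n}. p i \<otimes> q (n - i)) \<in> seqs"
  using subringE(6)[OF seqs_subring, of p q] UP_simps(2) by simp

lemma seqs_minus:
  assumes p: "p \<in> seqs"
  shows "(\<lambda>n. \<ominus> p n) \<in> seqs"
proof -
  obtain b where b: "bound \<zero> b p" using seqs_bound[OF p] by blast
  have "bound \<zero> b (\<lambda>n. \<ominus> p n)" using bound.bound[OF b] by (intro bound.intro) simp
  then show ?thesis by (rule seqsI[OF ideal_minus[OF pw_ideal seqs_pw[OF p]]])
qed

lemma gr_hom: "gr \<in> ring_hom (UP R\<lparr>carrier := seqs\<rparr>) G"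
proof (rule ring_hom_memI)
  show "gr (p \<oplus>\<^bsub>UP R\<lparr>carrier := seqs\<rparr>\<^esub> q) = gr p \<oplus>\<^bsub>G\<^esub> gr q"
    if "p \<in> carrier (UP R\<lparr>carrier := seqs\<rparr>)" "q \<in> carrier (UP R\<lparr>carrier := seqs\<rparr>)" for p q
    using that by (simp add: UP_simps gr_add)
qed (auto simp: G_carrier UP_simps gr_mult G_simps(2))

text \<open>The homomorphic image of a ring is a ring, here the image of the Rees algebra under
  \<open>gr\<close>. Its carrier and zero are those of \<open>G\<close>, so the record updates
  disappear.\<close>

lemma G_ring: "ring G"
proof -
  interpret P: UP_cring R "UP R" by unfold_locales
  interpret S: ring "UP R\<lparr>carrier := seqs\<rparr>" by (rule P.subring_is_ring[OF seqs_subring])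
  have "ring (G\<lparr>carrier := gr ` seqs, zero := gr \<zero>\<^bsub>UP R\<^esub>\<rparr>)"
    using S.ring_hom_imp_img_ring[OF gr_hom] by simp
  then show ?thesis by (simp add: UP_simps gr_zero flip: G_carrier)
qed

lemma gr_minus:
  assumes p: "p \<in> seqs"
  shows "\<ominus>\<^bsub>G\<^esub> gr p = gr (\<lambda>n. \<ominus> p n)"
proof -
  interpret G: ring G by (rule G_ring)
  have "gr (\<lambda>n. \<ominus> p n) \<oplus>\<^bsub>G\<^esub> gr p = \<zero>\<^bsub>G\<^esub>"
    using gr_add[OF seqs_minus[OF p] p] seqs_closed[OF p] by (simp add: l_neg gr_zero)
  then show ?thesis using p seqs_minus[OF p] by (intro G.minus_equality) (auto simp: G_carrier)
qed

lemma G_comm: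
  assumes "f \<in> carrier G" "g \<in> carrier G"
  shows "f \<otimes>\<^bsub>G\<^esub> g = g \<otimes>\<^bsub>G\<^esub> f"
proof -
  interpret P: UP_cring R "UP R" by unfold_locales
  obtain p q where pq: "p \<in> seqs" "q \<in> seqs" "f = gr p" "g = gr q" using assms G_carrier by auto
  then have "p \<otimes>\<^bsub>UP R\<^esub> q = q \<otimes>\<^bsub>UP R\<^esub> p" by (intro P.m_comm) (auto simp: seqs_def)
  then show ?thesis using pq by (simp add: gr_mult UP_simps)
qed

lemma gr_single_mult:
  assumes x: "x \<in> pw i" and p: "p \<in> seqs"
  shows "gr (single i x) \<otimes>\<^bsub>G\<^esub> gr p = (\<lambda>n. if i \<le> n then cls n (x \<otimes> p (n - i)) else pw (Suc n))"
proof
  fix n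
  have c: "x \<in> carrier R" "\<And>n. p n \<in> carrier R" using x p seqs_closed by auto
  have "(gr (single i x) \<otimes>\<^bsub>G\<^esub> gr p) n = cls n (\<Oplus>j\<in>{..n}. single i x j \<otimes> p (n - j))"
    using gr_mult[OF single_seqs[OF x] p] by (simp add: gr_def)
  also have "(\<Oplus>j\<in>{..n}. single i x j \<otimes> p (n - j)) = (\<Oplus>j\<in>{..n}. if i = j then x \<otimes> p (n - j) else \<zero>)"
    using c by (intro finsum_cong') (auto simp: single_def)
  also have "\<dots> = (if i \<le> n then x \<otimes> p (n - i) else \<zero>)"
  proof (cases "i \<le> n")
    case True
    then show ?thesis
      using finsum_singleton[of i "{..n}" "\<lambda>j. x \<otimes> p (n - j)"] c by simp
  next
    case False
    then have "(\<Oplus>j\<in>{..n}. if i = j then x \<otimes> p (n - j) else \<zero>) = (\<Oplus>j\<in>{..n}. \<zero>)"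
      by (intro finsum_cong') auto
    then show ?thesis using False by simp
  qed
  finally show "(gr (single i x) \<otimes>\<^bsub>G\<^esub> gr p) n = (if i \<le> n then cls n (x \<otimes> p (n - i)) else pw (Suc n))"
    by (simp add: cls_zero)
qed

lemma gr_single_mult_single:
  assumes "x \<in> pw i" "y \<in> pw j"
  shows "gr (single i x) \<otimes>\<^bsub>G\<^esub> gr (single j y) = gr (single (i + j) (x \<otimes> y))"
  unfolding gr_single_mult[OF assms(1) single_seqs[OF assms(2)]]
  using assms cls_zero by (intro ext) (auto simp: gr_def single_def pw_closed)

lemma gr_single_closed: "x \<in> pw i \<Longrightarrow> gr (single i x) \<in> carrier G"
  using single_seqs by (simp add: G_carrier)

lemma gr_const_eq: "gr_const R I a = gr (single 0 a)"
  by (simp add: gr_const_def gr_def single_def)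

lemma gr_component:
  "(\<lambda>i. if i = n then gr p i else \<zero>\<^bsub>G\<^esub> i) = gr (single n (p n))"
  by (rule ext) (simp add: gr_def single_def G_simps cls_zero)

lemma gr_eq_zero_iff: "p \<in> seqs \<Longrightarrow> gr p = \<zero>\<^bsub>G\<^esub> \<longleftrightarrow> (\<forall>n. p n \<in> pw (Suc n))"
  by (auto simp: gr_def G_simps fun_eq_iff cls_eq_zero_iff seqs_closed)

section \<open>The ideals C(a) and the quotients Q(a)\<close>

lemma gr_C_single_mem:
  assumes "x \<in> annihilator R (pw (u + 1 - a - i)) \<inter> pw i"
  shows "gr (single i x) \<in> gr_C R I u a"
proof -
  have "\<zero> \<in> annihilator R (pw (u + 1 - a - j)) \<inter> pw j" for j
    using ideal_zero[OF annihilator_ideal[OF ideal_subset[OF pw_ideal]]] ideal_zero[OF pw_ideal] by blast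
  then show ?thesis
    using assms gr_single_closed by (auto simp: gr_C_def gr_def single_def)
qed

lemma zero_in_gr_C: "\<zero>\<^bsub>G\<^esub> \<in> gr_C R I u a"
proof -
  have "\<zero> \<in> annihilator R (pw (u + 1 - a - j)) \<inter> pw j" for j
    using ideal_zero[OF annihilator_ideal[OF ideal_subset[OF pw_ideal]]] ideal_zero[OF pw_ideal] by blast
  from gr_C_single_mem[OF this] show ?thesis by (simp add: gr_zero single_def)
qed

text \<open>Vanishing may be tested degree by degree: monomials isolate a single component, and a
  class in degree i is zero when its representative lies in I^(i+1).\<close>

lemma gr_C_eq_zero_iff:
  "gr_C R I u a = {\<zero>\<^bsub>G\<^esub>} \<longleftrightarrow> (\<forall>i. annihilator R (pw (u + 1 - a - i)) \<inter> pw i \<subseteq> pw (Suc i))"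
proof
  assume C: "gr_C R I u a = {\<zero>\<^bsub>G\<^esub>}"
  show "\<forall>i. annihilator R (pw (u + 1 - a - i)) \<inter> pw i \<subseteq> pw (Suc i)"
  proof (intro allI subsetI)
    fix i x assume x: "x \<in> annihilator R (pw (u + 1 - a - i)) \<inter> pw i"
    then have "gr (single i x) = \<zero>\<^bsub>G\<^esub>" using gr_C_single_mem C by blast
    moreover have "single i x \<in> seqs" using x single_seqs by simp
    ultimately have "single i x i \<in> pw (Suc i)" by (simp only: gr_eq_zero_iff)
    then show "x \<in> pw (Suc i)" by (simp add: single_def)
  qed
next
  assume sub: "\<forall>i. annihilator R (pw (u + 1 - a - i)) \<inter> pw i \<subseteq> pw (Suc i)"
  have "f = \<zero>\<^bsub>G\<^esub>" if "f \<in> gr_C R I u a" for f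
  proof
    fix i
    have "f i \<in> cls i ` (annihilator R (pw (u + 1 - a - i)) \<inter> pw i)"
      using that unfolding gr_C_def by blast
    then obtain x where "f i = cls i x" "x \<in> annihilator R (pw (u + 1 - a - i)) \<inter> pw i" by blast
    then show "f i = \<zero>\<^bsub>G\<^esub> i" using sub cls_eq_zero_iff[of x i] by (auto simp: G_simps)
  qed
  then show "gr_C R I u a = {\<zero>\<^bsub>G\<^esub>}" using zero_in_gr_C by blast
qed

lemma gr_C_antimono: "a \<le> b \<Longrightarrow> gr_C R I u b \<subseteq> gr_C R I u a"
proof -
  assume "a \<le> b"
  then have "annihilator R (pw (u + 1 - b - i)) \<subseteq> annihilator R (pw (u + 1 - a - i))" for i
    by (intro annihilator_antimono pw_antimono) simp
  then show ?thesis by (fastforce simp: gr_C_def)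
qed

text \<open>Cosets of the zero ideal are singletons, so Q(a) is a copy of C(a). This is the step of
  a descending induction on a.\<close>

lemma gr_Q_eq_zero_iff:
  assumes "gr_C R I u (Suc a) = {\<zero>\<^bsub>G\<^esub>}"
  shows "gr_Q R I u a = {\<zero>\<^bsub>G Quot gr_C R I u (Suc a)\<^esub>} \<longleftrightarrow> gr_C R I u a = {\<zero>\<^bsub>G\<^esub>}"
proof -
  interpret G: ring G by (rule G_ring)
  have "gr_Q R I u a = (\<lambda>f. {f}) ` gr_C R I u a"
    unfolding gr_Q_def using assms
    by (intro image_cong) (auto simp: a_r_coset_def' gr_C_def)
  then show ?thesis using assms zero_in_gr_C[of u a] by (auto simp: FactRing_def)
qed

end

section \<open>Graded rings of Gorenstein local rings\<close>

locale gorenstein_graded = gorenstein_local R m F v + graded_ideal R I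
  for R (structure) and m F v I +
  fixes u :: nat
  assumes end_degree: "end_degree R I u"
begin

lemma pw_top: "pw u \<noteq> {\<zero>}" "pw (Suc u) = {\<zero>}"
  using end_degree by (simp_all add: end_degree_def)

lemma pw_above: "u < n \<Longrightarrow> pw n = {\<zero>}"
  using pw_antimono[of "Suc u" n] pw_top(2) ideal_zero[OF pw_ideal, of n] by auto

section \<open>The homogeneous maximal ideal of G(I)\<close>

lemma I_subset_m: "I \<subseteq> m"
proof (rule ccontr)
  assume "\<not> I \<subseteq> m"
  \<comment> \<open>If I were the whole ring, all its powers would contain 1, against the end
    degree.\<close>
  then have "I = carrier R" using ideal_eq_carrier[OF _ _ I_ideal] by blast
  then have one: "\<one> \<in> pw 1" using pw_1 by simp
  have "\<one> \<in> pw n" for n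
  proof (induction n)
    case (Suc n)
    then show ?case using pw_mult[OF one Suc] by simp
  qed (simp add: pw_0)
  then have "\<one> = \<zero>" using pw_top(2) by blast
  then show False using one_notin_m ideal_zero[OF m_ideal] by simp
qed

text \<open>The ideal m / I in degree 0 together with all positive degrees.\<close>

definition gmax :: "(nat \<Rightarrow> 'a set) set" where
  "gmax = gr ` {p \<in> seqs. p 0 \<in> m}"

text \<open>Two representatives of one class in degree 0 differ by an element of I, and I lies in
  m.\<close>

lemma gr_in_gmax_iff: "p \<in> seqs \<Longrightarrow> gr p \<in> gmax \<longleftrightarrow> p 0 \<in> m"
proof
  assume p: "p \<in> seqs" and "gr p \<in> gmax"
  then obtain q where q: "q \<in> seqs" "q 0 \<in> m" "gr p = gr q" by (auto simp: gmax_def)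
  then have "cls 0 (p 0) = cls 0 (q 0)" unfolding gr_def by metis
  then have "p 0 \<ominus> q 0 \<in> pw 1" using cls_eq_iff seqs_closed p q by simp
  then have "p 0 \<ominus> q 0 \<in> m" using I_subset_m pw_1 by auto
  then have "(p 0 \<ominus> q 0) \<oplus> q 0 \<in> m" using ideal_add[OF m_ideal _ q(2)] by simp
  then show "p 0 \<in> m" using seqs_closed[OF p] seqs_closed[OF q(1)]
    by (simp add: a_minus_def a_assoc l_neg)
qed (auto simp: gmax_def)

lemma gmax_ideal: "ideal gmax G"
proof (rule idealI)
  interpret G: ring G by (rule G_ring)
  show "ring G" by (rule G_ring)
  show "subgroup gmax (add_monoid G)"
  proof (rule G.add.subgroupI)
    show "gmax \<subseteq> carrier G" by (auto simp: gmax_def G_carrier)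
    show "gmax \<noteq> {}" using zero_seqs ideal_zero[OF m_ideal] by (auto simp: gmax_def)
  next
    fix f assume "f \<in> gmax"
    then obtain p where p: "p \<in> seqs" "p 0 \<in> m" "f = gr p" by (auto simp: gmax_def)
    then show "\<ominus>\<^bsub>G\<^esub> f \<in> gmax"
      by (simp add: gr_minus gr_in_gmax_iff seqs_minus ideal_minus[OF m_ideal])
  next
    fix f g assume "f \<in> gmax" "g \<in> gmax"
    then obtain p q where pq: "p \<in> seqs" "p 0 \<in> m" "f = gr p" "q \<in> seqs" "q 0 \<in> m" "g = gr q"
      by (auto simp: gmax_def)
    then show "f \<oplus>\<^bsub>G\<^esub> g \<in> gmax"
      by (simp add: gr_add gr_in_gmax_iff seqs_add ideal_add[OF m_ideal])
  qed
  fix f g assume f: "f \<in> gmax" and g: "g \<in> carrier G"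
  obtain p where p: "p \<in> seqs" "p 0 \<in> m" "f = gr p" using f by (auto simp: gmax_def)
  obtain q where q: "q \<in> seqs" "g = gr q" using g by (auto simp: G_carrier)
  have "q 0 \<otimes> p 0 \<in> m" using ideal_mult[OF m_ideal p(2) seqs_closed[OF q(1)]] .
  then show "g \<otimes>\<^bsub>G\<^esub> f \<in> gmax"
    using p q seqs_closed by (simp add: gr_mult gr_in_gmax_iff seqs_mult)
  moreover have "f \<in> carrier G" using p by (simp add: G_carrier)
  ultimately show "f \<otimes>\<^bsub>G\<^esub> g \<in> gmax" using G_comm g by metis
qed

lemma G_ideal_eq_carrier:
  assumes N: "ideal N G" and a: "a \<in> carrier R" "a \<notin> m" and mem: "gr (single 0 a) \<in> N"
  shows "N = carrier G"
proof -
  have au: "a \<in> Units R" using unit_of_notin_m a by simp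
  then have "gr (single 0 (inv a)) \<otimes>\<^bsub>G\<^esub> gr (single 0 a) = \<one>\<^bsub>G\<^esub>"
    using gr_single_mult_single[of "inv a" 0 a 0] a by (simp add: pw_0 G_simps)
  moreover have "gr (single 0 (inv a)) \<in> carrier G"
    using gr_single_closed[of "inv a" 0] au by (simp add: pw_0)
  ultimately have "\<one>\<^bsub>G\<^esub> \<in> N" using ideal.I_l_closed[OF N mem] by metis
  then show ?thesis by (rule ideal.one_imp_carrier[OF N])
qed

lemma one_notin_gmax: "\<one>\<^bsub>G\<^esub> \<notin> gmax"
  using gr_in_gmax_iff[of "single 0 \<one>"] single_seqs[of \<one> 0] one_notin_m
  by (simp add: G_simps pw_0 single_def)

lemma gmax_ne_carrier: "gmax \<noteq> carrier G"
  using one_notin_gmax ring.ring_simprules(6)[OF G_ring] by auto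

text \<open>An ideal N above \<open>gmax\<close> contains all positive degrees, hence the degree-0
  part of each of its elements. A degree-0 part outside m would be a unit and make N the whole
  ring.\<close>

lemma gmax_maximal: "maximalideal gmax G"
proof (rule maximalidealI[OF gmax_ideal gmax_ne_carrier[symmetric]])
  interpret G: ring G by (rule G_ring)
  fix N assume N: "ideal N G" "gmax \<subseteq> N" "N \<subseteq> carrier G"
  show "N = gmax \<or> N = carrier G"
  proof (rule disjCI)
    assume "N \<noteq> carrier G"
    have "f \<in> gmax" if f: "f \<in> N" for f
    proof -
      obtain p where p: "p \<in> seqs" "f = gr p" using f N(3) G_carrier by auto
      define q where "q = (\<lambda>n. if n = 0 then \<zero> else p n)"
      obtain b where b: "bound \<zero> b p" using seqs_bound[OF p(1)] by blast
      have q: "q \<in> seqs"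
      proof (rule seqsI)
        show "q n \<in> pw n" for n
          using seqs_pw[OF p(1)] ideal_zero[OF pw_ideal] by (simp add: q_def)
        show "bound \<zero> b q" using bound.bound[OF b] by (intro bound.intro) (simp add: q_def)
      qed
      have s: "single 0 (p 0) \<in> seqs" using single_seqs[OF seqs_pw[OF p(1), of 0]] .
      have "gr q \<in> N" using gr_in_gmax_iff[OF q] N(2) ideal_zero[OF m_ideal] by (auto simp: q_def)
      have "p = (\<lambda>n. single 0 (p 0) n \<oplus> q n)"
        using seqs_closed[OF p(1)] by (auto simp: single_def q_def)
      then have "f = gr (single 0 (p 0)) \<oplus>\<^bsub>G\<^esub> gr q" using gr_add[OF s q] p(2) by simp
      moreover have "gr (single 0 (p 0)) \<in> carrier G" "gr q \<in> carrier G"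
        using s q G_carrier by simp_all
      ultimately have "gr (single 0 (p 0)) = f \<ominus>\<^bsub>G\<^esub> gr q"
        by (simp add: a_minus_def G.a_assoc G.r_neg)
      then have "gr (single 0 (p 0)) \<in> N"
        using f \<open>gr q \<in> N\<close> N(1)
        by (simp add: a_minus_def additive_subgroup.a_closed additive_subgroup.a_inv_closed ideal.axioms(1))
      then have "p 0 \<in> m"
        using G_ideal_eq_carrier[OF N(1) seqs_closed[OF p(1)]] \<open>N \<noteq> carrier G\<close> by blast
      then show ?thesis using gr_in_gmax_iff[OF p(1)] p(2) by simp
    qed
    then show "N = gmax" using N(2) by blast
  qed
qed

lemma gmax_homogeneous: "gr_homogeneous R I gmax"
  unfolding gr_homogeneous_def
proof (intro ballI allI)
  fix f n assume "f \<in> gmax"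
  then obtain p where p: "p \<in> seqs" "p 0 \<in> m" "f = gr p" by (auto simp: gmax_def)
  have "single n (p n) 0 \<in> m" using p(2) ideal_zero[OF m_ideal] by (simp add: single_def)
  then show "(\<lambda>i. if i = n then f i else \<zero>\<^bsub>G\<^esub> i) \<in> gmax"
    unfolding p(3) gr_component using single_seqs[OF seqs_pw[OF p(1)]] gr_in_gmax_iff by blast
qed

text \<open>A homogeneous proper ideal contains the degree-0 parts of its elements, which therefore
  lie in m. So it is inside \<open>gmax\<close>, and a maximal one equals it; this is the uniqueness
  that \<open>THE\<close> requires.\<close>

lemma gr_max_eq: "gr_max R I = gmax"
  unfolding gr_max_def
proof (rule the_equality)
  show "maximalideal gmax G \<and> gr_homogeneous R I gmax"
    using gmax_maximal gmax_homogeneous by blast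
next
  fix N assume N: "maximalideal N G \<and> gr_homogeneous R I N"
  then have idN: "ideal N G" and ne: "N \<noteq> carrier G"
    using maximalideal.axioms(1) maximalideal.I_notcarr by blast+
  have "N \<subseteq> gmax"
  proof
    fix f assume f: "f \<in> N"
    then obtain p where p: "p \<in> seqs" "f = gr p" using ideal.Icarr[OF idN f] G_carrier by auto
    have "gr (single 0 (p 0)) \<in> N"
      using N f unfolding gr_homogeneous_def p(2) by (metis gr_component)
    then have "p 0 \<in> m" using G_ideal_eq_carrier[OF idN seqs_closed[OF p(1)]] ne by blast
    then show "f \<in> gmax" using gr_in_gmax_iff[OF p(1)] p(2) by simp
  qed
  moreover have "gmax \<subseteq> carrier G" by (auto simp: gmax_def G_carrier)
  ultimately show "N = gmax"
    using maximalideal.I_maximal[of N G gmax] N gmax_ideal gmax_ne_carrier by blast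
qed

section \<open>Elements of the socle of G(I)\<close>

lemma gr_socle_eq: "gr_socle R I = annihilator G gmax"
  by (simp add: gr_socle_def gr_max_eq)

text \<open>As G(I) is generated by its degrees 0 and 1, it suffices that m and I kill the class of
  x. The fact \<open>higher\<close> extends this to I^(k+1), by testing products of an element of I
  with one of I^k.\<close>

lemma single_in_socle:
  assumes x: "x \<in> pw i" and m: "\<And>a. a \<in> m \<Longrightarrow> x \<otimes> a \<in> pw (Suc i)"
    and I: "\<And>y. y \<in> I \<Longrightarrow> x \<otimes> y \<in> pw (i + 2)"
  shows "gr (single i x) \<in> gr_socle R I"
proof -
  have xc: "x \<in> carrier R" using x by blast
  have higher: "x \<otimes> y \<in> pw (Suc (i + Suc k))" if y: "y \<in> pw (Suc k)" for k y
  proof -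
    let ?N = "{y \<in> carrier R. x \<otimes> y \<in> pw (Suc (i + Suc k))}"
    have "pw (1 + k) \<subseteq> ?N"
    proof (rule pw_add_subsetI[OF colon_ideal[OF xc pw_ideal]])
      fix a b assume ab: "a \<in> pw 1" "b \<in> pw k"
      then have "x \<otimes> a \<in> pw (i + 2)" using I pw_1 by simp
      from pw_mult[OF this ab(2)] have "(x \<otimes> a) \<otimes> b \<in> pw (i + 2 + k)" .
      moreover have "a \<in> carrier R" "b \<in> carrier R" using ab by auto
      ultimately show "a \<otimes> b \<in> ?N" using xc by (simp add: m_assoc)
    qed
    then show ?thesis using y by auto
  qed
  have "gr (single i x) \<otimes>\<^bsub>G\<^esub> g = \<zero>\<^bsub>G\<^esub>" if g: "g \<in> gmax" for g
  proof -
    obtain p where p: "p \<in> seqs" "p 0 \<in> m" "g = gr p" using g by (auto simp: gmax_def)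
    have "x \<otimes> p (n - i) \<in> pw (Suc n)" if n: "i \<le> n" for n
    proof (cases "n - i")
      case 0
      then show ?thesis using m[OF p(2)] n by simp
    next
      case (Suc k)
      then have "i + Suc k = n" using n by simp
      then show ?thesis using higher[of "p (n - i)" k] seqs_pw[OF p(1), of "n - i"] Suc by simp
    qed
    then have "cls n (x \<otimes> p (n - i)) = pw (Suc n)" if "i \<le> n" for n
      using that xc seqs_closed[OF p(1)] by (simp add: cls_eq_zero_iff)
    then show ?thesis unfolding p(3) gr_single_mult[OF x p(1)] G_simps by (intro ext) simp
  qed
  then show ?thesis using gr_single_closed[OF x] by (simp add: gr_socle_eq annihilator_def)
qed

text \<open>Multiplication by the monomial y t^j isolates the n-th coefficient. For j = 0 that
  monomial lies in the maximal ideal only when y is in m.\<close>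

lemma socleD:
  assumes p: "p \<in> seqs" and soc: "gr p \<in> gr_socle R I"
    and y: "y \<in> pw j" and m: "j = 0 \<Longrightarrow> y \<in> m"
  shows "p n \<otimes> y \<in> pw (Suc (n + j))"
proof -
  have yc: "y \<in> carrier R" using y by blast
  have "single j y 0 \<in> m" using m ideal_zero[OF m_ideal] by (simp add: single_def)
  then have "gr (single j y) \<in> gmax" using gr_in_gmax_iff single_seqs[OF y] by blast
  then have "gr p \<otimes>\<^bsub>G\<^esub> gr (single j y) = \<zero>\<^bsub>G\<^esub>"
    using soc by (simp add: gr_socle_eq annihilator_def)
  moreover have "gr p \<otimes>\<^bsub>G\<^esub> gr (single j y) = gr (single j y) \<otimes>\<^bsub>G\<^esub> gr p"
    using p gr_single_closed[OF y] by (intro G_comm) (auto simp: G_carrier)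
  ultimately have "(gr (single j y) \<otimes>\<^bsub>G\<^esub> gr p) (n + j) = pw (Suc (n + j))" by (simp add: G_simps)
  then have "cls (n + j) (y \<otimes> p n) = pw (Suc (n + j))" by (simp add: gr_single_mult[OF y p])
  then have "y \<otimes> p n \<in> pw (Suc (n + j))" using cls_eq_zero_iff yc seqs_closed[OF p] by blast
  then show ?thesis using m_comm yc seqs_closed[OF p] by metis
qed

section \<open>Self-duality of the powers, against C(1) and against the Hilbert function\<close>

definition powers_self_dual :: bool where
  "powers_self_dual \<longleftrightarrow> (\<forall>i\<le>Suc u. pw i = ann (pw (Suc u - i)))"

lemma pw_subset_ann: "i \<le> Suc u \<Longrightarrow> pw i \<subseteq> ann (pw (Suc u - i))"
proof
  fix x assume i: "i \<le> Suc u" and x: "x \<in> pw i"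
  have "x \<otimes> y = \<zero>" if "y \<in> pw (Suc u - i)" for y
    using pw_mult[OF x that] i pw_top(2) by simp
  then show "x \<in> ann (pw (Suc u - i))" using x by (auto simp: annihilator_def)
qed

lemma C1_iff: "gr_C R I u 1 = {\<zero>\<^bsub>G\<^esub>} \<longleftrightarrow> (\<forall>i. ann (pw (u - i)) \<inter> pw i \<subseteq> pw (Suc i))"
  unfolding gr_C_eq_zero_iff by simp

lemma powers_self_dual_iff_C1: "powers_self_dual \<longleftrightarrow> gr_C R I u 1 = {\<zero>\<^bsub>G\<^esub>}"
proof
  assume p: powers_self_dual
  have "ann (pw (u - i)) \<subseteq> pw (Suc i)" for i
  proof (cases "i \<le> u")
    case True
    then show ?thesis using p[unfolded powers_self_dual_def, rule_format, of "Suc i"] by simp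
  next
    case False
    \<comment> \<open>For i > u the truncated difference is 0, and the annihilator of I^0 is
      zero.\<close>
    then show ?thesis using annihilator_carrier ideal_zero[OF pw_ideal] by (simp add: pw_0)
  qed
  then show "gr_C R I u 1 = {\<zero>\<^bsub>G\<^esub>}" unfolding C1_iff by blast
next
  assume "gr_C R I u 1 = {\<zero>\<^bsub>G\<^esub>}"
  then have sub: "\<And>i. ann (pw (u - i)) \<inter> pw i \<subseteq> pw (Suc i)" unfolding C1_iff by blast
  have "i \<le> Suc u \<longrightarrow> pw i = ann (pw (Suc u - i))" for i
  proof (induction i)
    case 0
    then show ?case by (simp add: pw_0 pw_top annihilator_zero)
  next
    case (Suc i)
    show ?case
    proof
      assume i: "Suc i \<le> Suc u"
      then have "ann (pw (u - i)) \<subseteq> ann (pw (Suc u - i))"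
        by (intro annihilator_antimono pw_antimono) simp
      \<comment> \<open>By induction I^i = (0 : I^(u+1-i)), which contains (0 : I^(u-i)); the
        intersection with I^i in C(1) therefore loses nothing.\<close>
      then have "ann (pw (u - i)) \<subseteq> pw i" using Suc i by simp
      then have "ann (pw (u - i)) \<subseteq> pw (Suc i)" using sub[of i] by blast
      then show "pw (Suc i) = ann (pw (Suc u - Suc i))" using pw_subset_ann[OF i] by simp
    qed
  qed
  then show powers_self_dual unfolding powers_self_dual_def by blast
qed

lemma HF_dual:
  assumes "i \<le> u"
  shows "gr_HF R I (int (u - i)) = ideal_length R (ann (pw (u - i))) (ann (pw (Suc u - i)))"
  unfolding gr_HF_eq using assms ideal_length_ann[OF pw_ideal[of "Suc (u - i)"] pw_ideal[of "u - i"]]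
  by (simp add: Suc_diff_le)

lemma powers_self_dual_iff_HF: "powers_self_dual \<longleftrightarrow> (\<forall>i\<le>u. gr_HF R I (int i) = gr_HF R I (int (u - i)))"
proof
  assume p: powers_self_dual
  show "\<forall>i\<le>u. gr_HF R I (int i) = gr_HF R I (int (u - i))"
  proof (intro allI impI)
    fix i assume i: "i \<le> u"
    have eq: "pw j = ann (pw (Suc u - j))" if "j \<le> Suc u" for j
      using p that unfolding powers_self_dual_def by blast
    have "gr_HF R I (int i) = ideal_length R (pw (Suc i)) (pw i)" by (rule gr_HF_eq)
    also have "\<dots> = ideal_length R (ann (pw (Suc u - Suc i))) (ann (pw (Suc u - i)))"
      using i by (intro arg_cong2[where f = "ideal_length R"] eq) simp_all
    finally show "gr_HF R I (int i) = gr_HF R I (int (u - i))"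
      unfolding HF_dual[OF i] by simp
  qed
next
  assume HF: "\<forall>i\<le>u. gr_HF R I (int i) = gr_HF R I (int (u - i))"
  have "i \<le> Suc u \<longrightarrow> pw i = ann (pw (Suc u - i))" for i
  proof (induction i)
    case 0
    then show ?case by (simp add: pw_0 pw_top annihilator_zero)
  next
    case (Suc i)
    show ?case
    proof
      assume i: "Suc i \<le> Suc u"
      then have eq: "ann (pw (Suc u - i)) = pw i" using Suc by simp
      have le: "ann (pw (u - i)) \<subseteq> pw i"
        unfolding eq[symmetric] by (intro annihilator_antimono pw_antimono) simp
      \<comment> \<open>The left side is HF(i), the right side HF(u-i) after dualising. Both
        intervals end at I^i, so a strict inclusion of their lower ends would make the lengths
        differ.\<close>
      have "ideal_length R (pw (Suc i)) (pw i) = ideal_length R (ann (pw (u - i))) (pw i)"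
        using HF[rule_format, of i] HF_dual[of i] i unfolding eq gr_HF_eq by simp
      then have "\<not> pw (Suc i) \<subset> ann (pw (u - i))"
        using ideal_length_strict[OF pw_ideal ann_ideal[OF pw_ideal] pw_ideal _ le, of "Suc i"] by auto
      then show "pw (Suc i) = ann (pw (Suc u - Suc i))" using pw_subset_ann[OF i] by auto
    qed
  qed
  then show powers_self_dual unfolding powers_self_dual_def by blast
qed

lemma HF_zero:
  assumes "i < 0 \<or> int u < i"
  shows "gr_HF R I i = 0"
proof (cases "i < 0")
  case False
  then obtain n where n: "i = int n" "u < n" using assms by (metis not_less of_nat_less_iff zero_le_imp_eq_int)
  then have "pw n = {\<zero>}" "pw (Suc n) = {\<zero>}" using pw_above by simp_all
  then show ?thesis unfolding n(1) gr_HF_eq by (simp add: ideal_length_self)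
qed (simp add: gr_HF_def)

lemma HF_symmetric_iff:
  "(\<forall>i. gr_HF R I i = gr_HF R I (int u - i)) \<longleftrightarrow>
     (\<forall>i\<le>u. gr_HF R I (int i) = gr_HF R I (int (u - i)))"
proof
  assume "\<forall>i. gr_HF R I i = gr_HF R I (int u - i)"
  then show "\<forall>i\<le>u. gr_HF R I (int i) = gr_HF R I (int (u - i))" by (simp add: of_nat_diff)
next
  assume HF: "\<forall>i\<le>u. gr_HF R I (int i) = gr_HF R I (int (u - i))"
  show "\<forall>i. gr_HF R I i = gr_HF R I (int u - i)"
  proof
    fix i :: int
    show "gr_HF R I i = gr_HF R I (int u - i)"
    proof (cases "i < 0 \<or> int u < i")
      case True
      \<comment> \<open>Reflection preserves the outside of 0..u, where both values are 0.\<close>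
      moreover from True have "int u - i < 0 \<or> int u < int u - i" by linarith
      ultimately show ?thesis by (simp only: HF_zero)
    next
      case False
      then obtain n where "i = int n" "n \<le> u" by (metis not_less of_nat_le_iff zero_le_imp_eq_int)
      then show ?thesis using HF by (simp add: of_nat_diff)
    qed
  qed
qed

section \<open>The socle of G(I) and its degree\<close>

lemma v_socle: "c \<in> F \<Longrightarrow> a \<in> m \<Longrightarrow> (c \<otimes> v) \<otimes> a = \<zero>"
  using socle by (auto simp: annihilator_def)

lemma socle_in_top: "c \<in> F \<Longrightarrow> c \<otimes> v \<in> pw u"
  using socle_subset[OF pw_ideal pw_top(1)] socle by auto

lemma gr_socle_if_C1:
  assumes C1: "gr_C R I u 1 = {\<zero>\<^bsub>G\<^esub>}"
  shows "gr_socle R I = (\<lambda>c. gr (single u (c \<otimes> v))) ` F"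
proof (intro equalityI subsetI)
  fix f assume f: "f \<in> gr_socle R I"
  then obtain p where p: "p \<in> seqs" "f = gr p"
    by (auto simp: gr_socle_eq annihilator_def G_carrier)
  have low: "p n \<in> pw (Suc n)" if "n < u" for n
  proof -
    \<comment> \<open>The product lies in I^(n+(u-n)+1) = I^(u+1) = 0. Since n < u, y has positive
      degree and the side condition on m is vacuous.\<close>
    have "p n \<otimes> y = \<zero>" if "y \<in> pw (u - n)" for y
      using socleD[OF p(1) f[unfolded p(2)] that, of n] \<open>n < u\<close> pw_top(2) by simp
    then have "p n \<in> ann (pw (u - n)) \<inter> pw n"
      using seqs_pw[OF p(1)] seqs_closed[OF p(1)] by (simp add: annihilator_def)
    then show ?thesis using C1 unfolding C1_iff by blast
  qed
  have high: "p n \<in> pw (Suc n)" if "u < n" for n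
    using seqs_pw[OF p(1), of n] pw_above[of n] pw_above[of "Suc n"] that by simp
  \<comment> \<open>In degree u vanishing modulo I^(u+1) is vanishing in the ring, so p u is a socle
    element of the ring.\<close>
  have "p u \<otimes> a = \<zero>" if "a \<in> m" for a
    using socleD[OF p(1) f[unfolded p(2)], of a 0 u] that m_subset pw_top(2) by (auto simp: pw_0)
  then have "p u \<in> ann m" using seqs_closed[OF p(1)] by (simp add: annihilator_def)
  then obtain c where c: "c \<in> F" "p u = c \<otimes> v" using socle by auto
  have "cls n (p n) = pw (Suc n)" if "n \<noteq> u" for n
    using that low[of n] high[of n] cls_eq_zero_iff seqs_closed[OF p(1)] by (meson linorder_neqE_nat)
  then have "gr p = gr (single u (p u))"
    unfolding gr_def single_def by (intro ext) (simp add: cls_zero)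
  then show "f \<in> (\<lambda>c. gr (single u (c \<otimes> v))) ` F" using c p(2) by auto
next
  fix f assume "f \<in> (\<lambda>c. gr (single u (c \<otimes> v))) ` F"
  then obtain c where c: "c \<in> F" "f = gr (single u (c \<otimes> v))" by blast
  have "gr (single u (c \<otimes> v)) \<in> gr_socle R I"
    using v_socle[OF c(1)] I_subset_m ideal_zero[OF pw_ideal]
    by (intro single_in_socle socle_in_top c) auto
  then show "f \<in> gr_socle R I" using c by simp
qed

text \<open>Some socle element c v is nonzero, because (0 : m) = 0 would make m the whole ring by
  the double annihilator property. It lies in I^u, and inverting c recovers v.\<close>

lemma v_top: "v \<in> pw u"
proof -
  obtain x where x: "x \<in> ann m" "x \<noteq> \<zero>"
  proof -
    have "ann m \<noteq> {\<zero>}"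
    proof
      assume "ann m = {\<zero>}"
      then have "m = carrier R" using ann_ann[OF m_ideal] annihilator_zero by simp
      then show False using one_notin_m by simp
    qed
    then show thesis using that ideal_ne_zero_obtain[OF ann_ideal[OF m_ideal]] by blast
  qed
  then obtain c where c: "c \<in> F" "x = c \<otimes> v" using socle by auto
  have "c \<noteq> \<zero>" using c x(2) v_closed by auto
  then have cu: "c \<in> Units R" using c(1) F_unit by simp
  then have "inv c \<otimes> (c \<otimes> v) = v"
    using v_closed by (metis Units_closed Units_inv_closed Units_l_inv l_one m_assoc)
  then show ?thesis using pw_mult_left[OF _ socle_in_top[OF c(1)], of "inv c"] cu by simp
qed

text \<open>The class of v in degree u is the basis vector of the socle over the image of F; it is
  nonzero because I^(u+1) = 0.\<close>

lemma gorenstein_if_C1: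
  assumes C1: "gr_C R I u 1 = {\<zero>\<^bsub>G\<^esub>}"
  shows "gr_gorenstein R F I u"
proof -
  interpret G: ring G by (rule G_ring)
  let ?w = "gr (single u v)"
  have wc: "?w \<in> carrier G" by (rule gr_single_closed[OF v_top])
  have "gr_const R I c \<otimes>\<^bsub>G\<^esub> ?w = gr (single u (c \<otimes> v))" if "c \<in> F" for c
    using gr_single_mult_single[OF _ v_top, of c 0] that F_subset by (auto simp: gr_const_eq pw_0)
  moreover have "gr (single u (c \<otimes> v)) \<in> carrier G" if "c \<in> F" for c
    by (rule gr_single_closed[OF socle_in_top[OF that]])
  ultimately have "G.line_extension (gr_const R I ` F) ?w {\<zero>\<^bsub>G\<^esub>} = gr_socle R I"
    unfolding gr_socle_if_C1[OF C1]
    by (auto simp: set_eq_iff G.line_extension_mem_iff image_iff)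
  moreover have "?w \<noteq> \<zero>\<^bsub>G\<^esub>"
  proof
    assume "?w = \<zero>\<^bsub>G\<^esub>"
    then have "single u v u \<in> pw (Suc u)" using gr_eq_zero_iff single_seqs[OF v_top] by blast
    then show False using pw_top(2) v_nonzero by (simp add: single_def)
  qed
  ultimately have "G.dimension 1 (gr_const R I ` F) (gr_socle R I)"
    using G.Suc_dim[OF wc _ G.zero_dim, of "gr_const R I ` F"] by simp
  moreover have "f n = \<zero>\<^bsub>G\<^esub> n" if "f \<in> gr_socle R I" "n \<noteq> u" for f n
    using that unfolding gr_socle_if_C1[OF C1] by (auto simp: gr_def single_def cls_zero G_simps)
  ultimately show ?thesis by (simp add: gr_gorenstein_def)
qed

text \<open>The largest degree \<open>i\<close> with \<open>C(1)\<^sub>i \<noteq> 0\<close> is annihilated by \<open>G(I)\<^sub>+\<close>, and a simple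
  \<open>A\<close>-submodule of \<open>C(1)\<^sub>i\<close> is annihilated by \<open>m\<close>. So \<open>C(1)\<^sub>i\<close> meets the socle, whence
  \<open>i = u\<close>, where \<open>C(1)\<^sub>u = 0\<close>.\<close>

lemma C1_if_socle_degree:
  assumes soc: "\<And>f n. f \<in> gr_socle R I \<Longrightarrow> n \<noteq> u \<Longrightarrow> f n = \<zero>\<^bsub>G\<^esub> n"
  shows "gr_C R I u 1 = {\<zero>\<^bsub>G\<^esub>}"
proof (rule ccontr)
  define D where "D i = ann (pw (u - i)) \<inter> pw i" for i
  assume "gr_C R I u 1 \<noteq> {\<zero>\<^bsub>G\<^esub>}"
  then obtain i0 where i0: "\<not> D i0 \<subseteq> pw (Suc i0)" unfolding C1_iff D_def by blast
  \<comment> \<open>For i at least u the exponent is 0, and the annihilator of I^0 is zero. This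
    bounds the degrees in which C(1) can be nonzero.\<close>
  have D_high: "D i \<subseteq> pw (Suc i)" if "u \<le> i" for i
    using that annihilator_carrier ideal_zero[OF pw_ideal] by (auto simp: D_def pw_0)
  have bdd: "i \<le> u" if "\<not> D i \<subseteq> pw (Suc i)" for i
    using D_high[of i] that by (cases "u \<le> i") auto
  define i where "i = (GREATEST i. \<not> D i \<subseteq> pw (Suc i))"
  have i: "\<not> D i \<subseteq> pw (Suc i)"
    unfolding i_def by (rule GreatestI_nat[where P = "\<lambda>i. \<not> D i \<subseteq> pw (Suc i)", OF i0 bdd])
  have max: "D j \<subseteq> pw (Suc j)" if "i < j" for j
    using Greatest_le_nat[where P = "\<lambda>i. \<not> D i \<subseteq> pw (Suc i)" and k = j, OF _ bdd] that
    unfolding i_def[symmetric] by (meson not_less)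
  have iu: "i < u" using D_high[of i] i by (cases "i < u") auto
  have idD: "ideal (D i) R"
    unfolding D_def by (intro i_intersect ann_ideal pw_ideal)
  have sub: "pw (Suc i) \<subseteq> D i"
    using pw_subset_ann[of "Suc i"] iu pw_antimono[of i "Suc i"] by (auto simp: D_def)
  \<comment> \<open>These ideals stand for the nonzero submodules of C(1)_i = D i / I^(i+1); a
    minimal one gives a simple submodule.\<close>
  define S where "S = {Z. ideal Z R \<and> pw (Suc i) \<subset> Z \<and> Z \<subseteq> D i}"
  have "S \<noteq> {}" using idD sub i by (auto simp: S_def)
  moreover have "ideal N R" if "N \<in> S" for N using that by (simp add: S_def)
  ultimately have "\<exists>M\<in>S. \<forall>N'\<in>S. N' \<subseteq> M \<longrightarrow> N' = M" by (rule artinian_minimal[OF artinian])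
  then obtain Z where ZS: "Z \<in> S" and min: "\<And>N'. N' \<in> S \<Longrightarrow> N' \<subseteq> Z \<Longrightarrow> N' = Z" by blast
  then have Z: "ideal Z R" "pw (Suc i) \<subset> Z" "Z \<subseteq> D i" by (simp_all add: S_def)
  have cov: "ideal_covers R (pw (Suc i)) Z"
    unfolding ideal_covers_def
  proof (intro conjI allI impI Z pw_ideal)
    fix N assume N: "ideal N R" "pw (Suc i) \<subseteq> N" "N \<subseteq> Z"
    show "N = pw (Suc i) \<or> N = Z"
    proof (rule disjCI)
      assume "N \<noteq> Z"
      then have "N \<notin> S" using min N(3) by blast
      then show "N = pw (Suc i)" using N Z(3) unfolding S_def by blast
    qed
  qed
  obtain x where x: "x \<in> Z" "x \<notin> pw (Suc i)" using Z(2) by blast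
  have xD: "x \<in> D i" using x(1) Z(3) by blast
  then have xp: "x \<in> pw i" and xa: "x \<in> ann (pw (u - i))" by (simp_all add: D_def)
  have xc: "x \<in> carrier R" using xp by blast
  have "gr (single i x) \<in> gr_socle R I"
  proof (rule single_in_socle[OF xp])
    fix a assume a: "a \<in> m"
    have "a \<otimes> x \<in> pw (Suc i)" by (rule m_mult_covers[OF cov x(1) a])
    then show "x \<otimes> a \<in> pw (Suc i)" using m_comm xc a m_subset by (metis subsetD)
  next
    fix y assume y: "y \<in> I"
    then have y1: "y \<in> pw 1" using pw_1 by simp
    then have yc: "y \<in> carrier R" by blast
    have "(x \<otimes> y) \<otimes> z = \<zero>" if z: "z \<in> pw (u - Suc i)" for z
    proof -
      have "y \<otimes> z \<in> pw (u - i)" using pw_mult[OF y1 z] iu by (simp add: Suc_diff_Suc)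
      then have "x \<otimes> (y \<otimes> z) = \<zero>" using xa by (simp add: annihilator_def)
      then show ?thesis using xc yc z by (simp add: m_assoc pw_closed)
    qed
    moreover have "x \<otimes> y \<in> pw (Suc i)" using pw_mult[OF xp y1] by simp
    ultimately have "x \<otimes> y \<in> D (Suc i)" using xc yc by (simp add: D_def annihilator_def)
    then show "x \<otimes> y \<in> pw (i + 2)" using max[of "Suc i"] by auto
  qed
  from soc[OF this, of i] have "cls i x = pw (Suc i)"
    using iu by (simp add: gr_def single_def G_simps)
  then show False using x(2) xc cls_eq_zero_iff by simp
qed

theorem graded_gorenstein_equivalences:
  "(gr_gorenstein R F I u \<longleftrightarrow> gr_C R I u 1 = {\<zero>\<^bsub>G\<^esub>}) \<and>
   (gr_C R I u 1 = {\<zero>\<^bsub>G\<^esub>} \<longleftrightarrow> (\<forall>i\<ge>1. gr_C R I u i = {\<zero>\<^bsub>G\<^esub>})) \<and>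
   ((\<forall>i\<ge>1. gr_C R I u i = {\<zero>\<^bsub>G\<^esub>}) \<longleftrightarrow>
      (\<forall>i\<ge>1. gr_Q R I u i = {\<zero>\<^bsub>G Quot gr_C R I u (i + 1)\<^esub>})) \<and>
   ((\<forall>i\<ge>1. gr_Q R I u i = {\<zero>\<^bsub>G Quot gr_C R I u (i + 1)\<^esub>}) \<longleftrightarrow>
      (\<forall>i. gr_HF R I i = gr_HF R I (int u - i)))"
proof -
  let ?C1 = "gr_C R I u 1 = {\<zero>\<^bsub>G\<^esub>}" and ?C = "\<forall>i\<ge>1. gr_C R I u i = {\<zero>\<^bsub>G\<^esub>}"
    and ?Q = "\<forall>i\<ge>1. gr_Q R I u i = {\<zero>\<^bsub>G Quot gr_C R I u (i + 1)\<^esub>}"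
  have i_ii: "gr_gorenstein R F I u \<longleftrightarrow> ?C1"
  proof
    assume "gr_gorenstein R F I u"
    then show ?C1 unfolding gr_gorenstein_def by (intro C1_if_socle_degree) simp
  qed (rule gorenstein_if_C1)
  have ii_iii: "?C1 \<longleftrightarrow> ?C"
  proof
    assume C1: ?C1
    show ?C
    proof (intro allI impI)
      fix i :: nat assume "1 \<le> i"
      then show "gr_C R I u i = {\<zero>\<^bsub>G\<^esub>}"
        using gr_C_antimono[of 1 i u] C1 zero_in_gr_C[of u i] by blast
    qed
  qed simp
  have iii_iv: "?C \<longleftrightarrow> ?Q"
  proof
    assume C: ?C
    show ?Q
    proof (intro allI impI)
      fix i :: nat assume "1 \<le> i"
      then show "gr_Q R I u i = {\<zero>\<^bsub>G Quot gr_C R I u (i + 1)\<^esub>}"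
        using gr_Q_eq_zero_iff[of u i] C by simp
    qed
  next
    assume Q: ?Q
    have "gr_C R I u i = {\<zero>\<^bsub>G\<^esub>}" if "1 \<le> i" "i \<le> Suc u" for i
      using that(2,1)
    proof (induction i rule: inc_induct)
      case base
      \<comment> \<open>The exponents in C(u+1) are all truncated to 0, so C(u+1) = 0. From there
        Q(i) = 0 carries vanishing from i + 1 down to i.\<close>
      have "ann (pw 0) \<inter> pw i \<subseteq> pw (Suc i)" for i
        using annihilator_carrier ideal_zero[OF pw_ideal] by (auto simp: pw_0)
      then show ?case unfolding gr_C_eq_zero_iff by simp
    next
      case (step i)
      then show ?case using gr_Q_eq_zero_iff[of u i] Q by simp
    qed
    then have "gr_C R I u 1 = {\<zero>\<^bsub>G\<^esub>}" by simp
    then show ?C using ii_iii by simp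
  qed
  show ?thesis
    using i_ii ii_iii iii_iv powers_self_dual_iff_C1 powers_self_dual_iff_HF HF_symmetric_iff by argo
qed

end

section \<open>From the stated hypotheses to the elementwise setting\<close>

lemma (in ring) dimension_one_obtain:
  assumes "dimension 1 K E" "K \<subseteq> carrier R"
  obtains v where "v \<in> carrier R" "v \<noteq> \<zero>" "E = (\<lambda>c. c \<otimes> v) ` K"
proof -
  \<comment> \<open>The inductive definition is inverted twice: a one-dimensional space is a line
    added to a space of dimension 0, which is zero.\<close>
  obtain v E' where v: "v \<in> carrier R" "v \<notin> E'" "dimension 0 K E'" "E = line_extension K v E'"
    using assms(1) by (cases rule: dimension.cases) auto
  have E': "E' = {\<zero>}" using v(3) by (cases rule: dimension.cases) auto
  have "E = (\<lambda>c. c \<otimes> v) ` K"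
    unfolding v(4) E' using assms(2) v(1)
    by (auto simp: set_eq_iff line_extension_mem_iff image_iff subset_iff)
  then show thesis using v(1,2) E' that by blast
qed

theorem theorem3p8:
  fixes K :: "('k, 'c) ring_scheme"
    and R :: "('k, 'a, 'd) module_scheme"
    and M J :: "'a set"
    and I :: "'a set set"
    and u :: nat
  defines "A \<equiv> R Quot J"
    and "F \<equiv> (\<lambda>c. J +>\<^bsub>R\<^esub> (c \<odot>\<^bsub>R\<^esub> \<one>\<^bsub>R\<^esub>)) ` carrier K"
    and "\<mm> \<equiv> (\<lambda>x. J +>\<^bsub>R\<^esub> x) ` M"
  assumes "field K" and "algebra K R" and "local_ring R M"
    and "(\<lambda>c. M +>\<^bsub>R\<^esub> (c \<odot>\<^bsub>R\<^esub> \<one>\<^bsub>R\<^esub>)) \<in> ring_iso K (R Quot M)"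
    and "ideal J R" and "artinian_gorenstein A F \<mm>"
    and "ideal I A" and "end_degree A I u"
  shows "(gr_gorenstein A F I u \<longleftrightarrow> gr_C A I u 1 = {\<zero>\<^bsub>gr_ring A I\<^esub>}) \<and>
         (gr_C A I u 1 = {\<zero>\<^bsub>gr_ring A I\<^esub>} \<longleftrightarrow>
            (\<forall>i\<ge>1. gr_C A I u i = {\<zero>\<^bsub>gr_ring A I\<^esub>})) \<and>
         ((\<forall>i\<ge>1. gr_C A I u i = {\<zero>\<^bsub>gr_ring A I\<^esub>}) \<longleftrightarrow>
            (\<forall>i\<ge>1. gr_Q A I u i = {\<zero>\<^bsub>gr_ring A I Quot gr_C A I u (i + 1)\<^esub>})) \<and>
         ((\<forall>i\<ge>1. gr_Q A I u i = {\<zero>\<^bsub>gr_ring A I Quot gr_C A I u (i + 1)\<^esub>}) \<longleftrightarrow>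
            (\<forall>i :: int. gr_HF A I i = gr_HF A I (int u - i)))"
proof -
  interpret K: field K by fact
  interpret R: algebra K R by fact
  interpret J: ideal J R by fact
  have loc: "local_ring A \<mm>" and art: "artinian_ring A"
    and dim: "ring.dimension A 1 F (annihilator A \<mm>)"
    using assms by (simp_all add: artinian_gorenstein_def)
  interpret A: cring A using loc by (simp add: local_ring_def)
  interpret mm: maximalideal \<mm> A using loc by (simp add: local_ring_def)
  have hom: "(\<lambda>x. J +>\<^bsub>R\<^esub> x) \<in> ring_hom R A" unfolding A_def by (rule J.rcos_ring_hom)
  have smult: "c \<odot>\<^bsub>R\<^esub> \<one>\<^bsub>R\<^esub> \<in> carrier R" if "c \<in> carrier K" for c
    by (intro R.smult_closed that R.one_closed)
  have F: "F \<subseteq> carrier A" unfolding F_def using ring_hom_closed[OF hom] smult by blast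
  \<comment> \<open>A nonzero element of F is the image of a nonzero scalar c, and the image of 1 /
    c is its inverse.\<close>
  have unit: "a \<in> Units A" if a: "a \<in> F" "a \<noteq> \<zero>\<^bsub>A\<^esub>" for a
  proof -
    obtain c where c: "c \<in> carrier K" "a = J +>\<^bsub>R\<^esub> (c \<odot>\<^bsub>R\<^esub> \<one>\<^bsub>R\<^esub>)" using a(1) by (auto simp: F_def)
    have z1: "\<zero>\<^bsub>K\<^esub> \<odot>\<^bsub>R\<^esub> \<one>\<^bsub>R\<^esub> = \<zero>\<^bsub>R\<^esub>" by (intro R.smult_l_null R.one_closed)
    have z2: "J +>\<^bsub>R\<^esub> \<zero>\<^bsub>R\<^esub> = \<zero>\<^bsub>A\<^esub>" by (rule ring_hom_zero[OF hom R.ring_axioms A.ring_axioms])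
    have "c \<noteq> \<zero>\<^bsub>K\<^esub>"
    proof
      assume "c = \<zero>\<^bsub>K\<^esub>"
      then have "a = \<zero>\<^bsub>A\<^esub>" unfolding c(2) by (simp only: z1 z2)
      then show False using a(2) by simp
    qed
    then have d: "inv\<^bsub>K\<^esub> c \<in> carrier K" "c \<otimes>\<^bsub>K\<^esub> inv\<^bsub>K\<^esub> c = \<one>\<^bsub>K\<^esub>"
      using K.field_Units c(1) by auto
    let ?d = "inv\<^bsub>K\<^esub> c"
    have "(c \<odot>\<^bsub>R\<^esub> \<one>\<^bsub>R\<^esub>) \<otimes>\<^bsub>R\<^esub> (?d \<odot>\<^bsub>R\<^esub> \<one>\<^bsub>R\<^esub>) = (c \<otimes>\<^bsub>K\<^esub> ?d) \<odot>\<^bsub>R\<^esub> \<one>\<^bsub>R\<^esub>"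
      using c(1) d(1) smult[OF d(1)] by (simp add: R.smult_assoc1 R.smult_assoc2)
    also have "\<dots> = \<one>\<^bsub>R\<^esub>" unfolding d(2) by (intro R.smult_one R.one_closed)
    finally have "a \<otimes>\<^bsub>A\<^esub> (J +>\<^bsub>R\<^esub> (?d \<odot>\<^bsub>R\<^esub> \<one>\<^bsub>R\<^esub>)) = \<one>\<^bsub>A\<^esub>"
      using ring_hom_mult[OF hom smult[OF c(1)] smult[OF d(1)]] ring_hom_one[OF hom] c(2) by simp
    moreover have "J +>\<^bsub>R\<^esub> (?d \<odot>\<^bsub>R\<^esub> \<one>\<^bsub>R\<^esub>) \<in> carrier A" "a \<in> carrier A"
      using ring_hom_closed[OF hom smult[OF d(1)]] F a(1) by auto
    ultimately show ?thesis unfolding Units_def using A.m_comm by (intro CollectI conjI) metis+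
  qed
  obtain v where v: "v \<in> carrier A" "v \<noteq> \<zero>\<^bsub>A\<^esub>" "annihilator A \<mm> = (\<lambda>c. c \<otimes>\<^bsub>A\<^esub> v) ` F"
    by (rule A.dimension_one_obtain[OF dim F])
  have local_unit: "a \<in> Units A" if a: "a \<in> carrier A" "a \<notin> \<mm>" for a
  proof (rule ccontr)
    assume "a \<notin> Units A"
    then obtain N where "maximalideal N A" "a \<in> N" by (rule A.nonunit_in_maximalideal[OF a(1)])
    then show False using loc a(2) unfolding local_ring_def by blast
  qed
  have one: "\<one>\<^bsub>A\<^esub> \<notin> \<mm>" using mm.one_imp_carrier mm.I_notcarr by blast
  interpret gorenstein_graded A \<mm> F v I u
    by (intro gorenstein_graded.intro gorenstein_local.intro gorenstein_local_axioms.intro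
        graded_ideal.intro graded_ideal_axioms.intro gorenstein_graded_axioms.intro)
      (fact A.cring_axioms mm.is_ideal one art F v local_unit unit assms)+
  show ?thesis by (rule graded_gorenstein_equivalences)
qed

end
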